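(* Let $p>1$ be a real number and $n>1$ an integer, with $p$ and $n$ not both equal to $2$, and let $p'=p/(p-1)$. The real function $\sin_{p,n}$ has an analytic extension at $\frac12\pi_{p,n}$ (i.e. it extends to a function that is real-analytic on an open interval containing $\frac12\pi_{p,n}$) if and only if $p'$ is an integer. When $p'$ is an integer, $\frac12\pi_{p,n}$ is a critical point of order $p'-1$ of the extended function, and the Taylor series of the extended function at $\frac12\pi_{p,n}$ has radius of convergence $\mu(p',n)$.
   Context: For real $p>1$ and integer $n>1$ (not both equal to $2$), set $a_n=-\infty$ for $n$ odd and $a_n=-1$ for $n$ even, and let $$F_{p,n}(y)=\int_0^y \frac{1}{(1-t^n)^{1/p}}\,dt$$ for real $y\in(a_n,1]$ (and also for $y=-1$ when $n$ is even). Put $\pi_{p,n}:=2F_{p,n}(1)$. For $n$ odd, $F_{p,n}(-\infty):=\lim_{y\to-\infty}F_{p,n}(y)\in[-\infty,0)$. The function $F_{p,n}$ is strictly increasing, and the real function $\sin_{p,n}$ is defined as its inverse: $$\sin_{p,n}:=F_{p,n}^{-1}:\left[-\tfrac12\pi_{p,n},\tfrac12\pi_{p,n}\right]\to[-1,1]\ \text{ for } n \text{ even},\qquad \sin_{p,n}:=F_{p,n}^{-1}:\left(F_{p,n}(-\infty),\tfrac12\pi_{p,n}\right]\to(-\infty,1]\ \text{ for } n \text{ odd}.$$ The conjugate of $p$ is $p':=p/(p-1)$, so $\frac1p+\frac1{p'}=1$. Also $$\mu(m,n):=\int_1^\infty \frac{1}{(t^n-1)^{(m-1)/m}}\,dt.$$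 A point $x_0$ is a critical point of order $k$ of an analytic function $f$ if $f'$ has a zero of order exactly $k$ at $x_0$. *)

theory Defs
  imports "HOL-Analysis.Analysis"
begin

definition conj_exp :: "real \<Rightarrow> real" where
  "conj_exp p = p / (p - 1)"

(* The interval integral is oriented, so for y < 0 this is minus the integral over [y,0].
   The value is only meaningful for y in dom_F n.  At the endpoints where 1 - t^n = 0 the
   integrand takes the value 0, which does not affect the integral. *)
definition F_pn :: "real \<Rightarrow> nat \<Rightarrow> real \<Rightarrow> real" where
  "F_pn p n y = (LBINT t=0..ereal y. 1 / (1 - t ^ n) powr (1 / p))"

definition dom_F :: "nat \<Rightarrow> real set" where
  "dom_F n = (if even n then {-1..1} else {..1})"

definition pi_pn :: "real \<Rightarrow> nat \<Rightarrow> real" where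
  "pi_pn p n = 2 * F_pn p n 1"

(* The limit of F_pn at minus infinity, for odd n; it is taken in the extended reals because
   it may be minus infinity. *)
definition F_minf :: "real \<Rightarrow> nat \<Rightarrow> ereal" where
  "F_minf p n = Lim at_bot (\<lambda>y. ereal (F_pn p n y))"

definition dom_sin :: "real \<Rightarrow> nat \<Rightarrow> real set" where
  "dom_sin p n =
     (if even n then {- (pi_pn p n / 2) .. pi_pn p n / 2}
      else {x. F_minf p n < ereal x \<and> x \<le> pi_pn p n / 2})"

(* Only meaningful on dom_sin p n. *)
definition sin_pn :: "real \<Rightarrow> nat \<Rightarrow> real \<Rightarrow> real" where
  "sin_pn p n = inv_into (dom_F n) (F_pn p n)"

definition mu :: "real \<Rightarrow> nat \<Rightarrow> real" where
  "mu m n = (LBINT t=1..\<infinity>. 1 / (t ^ n - 1) powr ((m - 1) / m))"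

definition real_analytic_on :: "(real \<Rightarrow> real) \<Rightarrow> real set \<Rightarrow> bool" where
  "real_analytic_on f S \<longleftrightarrow> (\<forall>x\<in>S. \<exists>A. (\<lambda>h. f (x + h)) has_fps_expansion A)"

(* g extends sin_pn from all of its domain; the values of g outside that domain and outside
   the open interval are unconstrained. *)
definition analytic_extension :: "real \<Rightarrow> nat \<Rightarrow> (real \<Rightarrow> real) \<Rightarrow> bool" where
  "analytic_extension p n g \<longleftrightarrow>
     (\<forall>x\<in>dom_sin p n. g x = sin_pn p n x) \<and>
     (\<exists>a b. a < pi_pn p n / 2 \<and> pi_pn p n / 2 < b \<and> real_analytic_on g {a<..<b})"

definition zero_of_order :: "(real \<Rightarrow> real) \<Rightarrow> real \<Rightarrow> nat \<Rightarrow> bool" where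
  "zero_of_order h x k \<longleftrightarrow> (\<forall>j<k. (deriv ^^ j) h x = 0) \<and> (deriv ^^ k) h x \<noteq> 0"

definition critical_point_of_order :: "(real \<Rightarrow> real) \<Rightarrow> real \<Rightarrow> nat \<Rightarrow> bool" where
  "critical_point_of_order f x k \<longleftrightarrow> zero_of_order (deriv f) x k"

definition taylor_fps :: "(real \<Rightarrow> real) \<Rightarrow> real \<Rightarrow> real fps" where
  "taylor_fps f x = Abs_fps (\<lambda>k. (deriv ^^ k) f x / fact k)"

end

theory Submission
  imports Defs "HOL-Complex_Analysis.Complex_Analysis"
begin

text \<open>
  Throughout, \<open>p' = p / (p - 1)\<close>. Near \<open>pi_pn p n / 2\<close> the function \<open>S z = sin_pn p n (pi_pn p n / 2 - z)\<close>
  satisfies, for small \<open>z > 0\<close>, the equation \<open>S' = - (1 - S ^ n) powr (1 / p)\<close> with \<open>S 0 = 1\<close>.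

  If an analytic extension exists, comparing the orders of vanishing of the two sides at \<open>z = 0\<close>
  forces \<open>p'\<close> to be the order of the zero of \<open>1 - S\<close>, hence an integer
  (\<open>conj_exp_eq_if_analytic_extension\<close>).

  If \<open>p' = m\<close> is an integer, then \<open>1 / p = (m - 1) / m\<close>, and introducing \<open>W = (1 - S ^ n) powr (1 / m)\<close>
  turns the singular equation into the polynomial system
  \<open>S' = - W ^ (m - 1)\<close>, \<open>W' = (n / m) * S ^ (n - 1)\<close>, \<open>S 0 = 1\<close>, \<open>W 0 = 0\<close>.
  It has a power series solution of the form \<open>S z = P (- (z ^ m))\<close>, \<open>W z = z * Q (- (z ^ m))\<close> with nonnegative
  coefficients in \<open>P\<close> and \<open>Q\<close> (locale \<open>polynomial_system\<close>). This gives the extension, and as the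
  coefficient \<open>1\<close> of \<open>P\<close> is positive, the first nonconstant term has degree \<open>m\<close>: the critical point has
  order \<open>m - 1\<close>.

  For the radius of convergence, note that \<open>P (z ^ m)\<close> has the same radius as \<open>P (- (z ^ m))\<close>. For real
  \<open>z \<ge> 0\<close> the function \<open>A z = P (z ^ m)\<close> satisfies \<open>A' = (A ^ n - 1) powr (1 / p)\<close>; it reaches the value
  \<open>y\<close> at the time \<open>\<integral> 1 / (t ^ n - 1) powr (1 / p)\<close> over \<open>[1, y]\<close> and blows up at the time \<open>mu m n\<close>. So the
  radius is at most \<open>mu m n\<close> (\<open>Phi_eval\<close>). It is not smaller: as all coefficients are
  nonnegative, the partial sums increase and are bounded by the value of the trajectory, at every
  time before the blow-up (\<open>partial_sums_le\<close>).
\<close>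

section \<open>The integral that defines the inverse of the generalized sine\<close>

lemma powr_singularity_integrable:
  fixes a c d :: real
  assumes "0 < a" "a < 1"
  shows "(\<lambda>t. (c - t) powr (-a)) integrable_on {d..c}"
    and "(\<lambda>t. (t - c) powr (-a)) integrable_on {c..d}"
proof -
  show "(\<lambda>t. (c - t) powr (-a)) integrable_on {d..c}"
  proof (cases "d \<le> c")
    case True
    have "((\<lambda>t. (c - t) powr (-a)) has_integral
            - ((c - c) powr (1 - a) / (1 - a)) - - ((c - d) powr (1 - a) / (1 - a))) {d..c}"
    proof (rule fundamental_theorem_of_calculus_interior[OF True])
      show "continuous_on {d..c} (\<lambda>t. - ((c - t) powr (1 - a) / (1 - a)))"
        using assms by (intro continuous_intros continuous_on_powr') auto
      fix t assume "t \<in> {d<..<c}"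
      then show "((\<lambda>t. - ((c - t) powr (1 - a) / (1 - a))) has_vector_derivative (c - t) powr (-a)) (at t)"
        using assms
        by (auto simp flip: has_real_derivative_iff_has_vector_derivative
                 intro!: derivative_eq_intros simp: divide_simps)
    qed
    then show ?thesis by blast
  qed auto
  show "(\<lambda>t. (t - c) powr (-a)) integrable_on {c..d}"
  proof (cases "c \<le> d")
    case True
    have "((\<lambda>t. (t - c) powr (-a)) has_integral
            (d - c) powr (1 - a) / (1 - a) - (c - c) powr (1 - a) / (1 - a)) {c..d}"
    proof (rule fundamental_theorem_of_calculus_interior[OF True])
      show "continuous_on {c..d} (\<lambda>t. (t - c) powr (1 - a) / (1 - a))"
        using assms by (intro continuous_intros continuous_on_powr') auto
      fix t assume "t \<in> {c<..<d}"
      then show "((\<lambda>t. (t - c) powr (1 - a) / (1 - a)) has_vector_derivative (t - c) powr (-a)) (at t)"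
        using assms
        by (auto simp flip: has_real_derivative_iff_has_vector_derivative
                 intro!: derivative_eq_intros simp: divide_simps)
    qed
    then show ?thesis by blast
  qed auto
qed

lemma set_integrable_lborel_comparison:
  fixes f g :: "real \<Rightarrow> real"
  assumes "f \<in> borel_measurable borel" "g integrable_on {a..b}"
    and "\<And>t. t \<in> {a..b} \<Longrightarrow> \<bar>f t\<bar> \<le> g t"
  shows "set_integrable lborel {a..b} f"
proof -
  have meas: "f \<in> borel_measurable (lebesgue_on {a..b})"
    using assms(1) by (simp add: measurable_completion measurable_restrict_space1)
  have "f integrable_on {a..b}"
    by (rule measurable_bounded_by_integrable_imp_integrable_real[OF meas assms(2,3)]) auto
  then have "f absolutely_integrable_on {a..b}"
    using assms(2,3) by (intro absolutely_integrable_integrable_bound[of "{a..b}" f g]) auto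
  then show ?thesis
    using assms(1) unfolding set_integrable_def
    by (subst (asm) integrable_completion) auto
qed

lemma one_minus_power_pos:
  fixes t :: real
  assumes "n > 0" "t < 1" "even n \<Longrightarrow> -1 < t"
  shows "0 < 1 - t ^ n"
proof (cases "t \<ge> 0")
  case True
  then show ?thesis using assms by (simp add: power_less_one_iff)
next
  case False
  show ?thesis
  proof (cases "even n")
    case True
    then have "\<bar>t\<bar> ^ n < 1" using False assms by (subst power_less_one_iff) auto
    then show ?thesis using power_even_abs[OF True, of t] by linarith
  next
    case odd: False
    then have "t ^ n < 0" using False by simp
    then show ?thesis by linarith
  qed
qed

text \<open>The integrand is singular only at \<open>1\<close> and, for even exponents, at \<open>-1\<close>. Since
  \<open>1 - t ^ n \<ge> 1 - \<bar>t\<bar>\<close> on \<open>[-1, 1]\<close>, these singularities are no worse than \<open>\<bar>1 \<mp> t\<bar> powr (- 1 / p)\<close>,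
  which is integrable because \<open>p > 1\<close>.\<close>
lemma F_integrand_integrable:
  fixes a p :: real
  assumes "p > 1" "n > 0" "a \<in> dom_F n"
  shows "set_integrable lborel {a..1} (\<lambda>t. 1 / (1 - t ^ n) powr (1 / p))"
proof (rule set_integrable_lborel_comparison)
  show "(\<lambda>t. 1 / (1 - t ^ n) powr (1 / p)) \<in> borel_measurable borel" by measurable
  have "(\<lambda>t::real. (t - (-1)) powr (- (1 / p))) integrable_on {a..1}" if "even n"
    using powr_singularity_integrable(2)[of "1 / p" "-1" 1] assms that
    by (auto intro: integrable_on_subinterval simp: dom_F_def)
  then have "(\<lambda>t::real. if even n then (t - (-1)) powr (- (1 / p)) else 0) integrable_on {a..1}"
    by (cases "even n") auto
  then show "(\<lambda>t. (1 - t) powr (- (1 / p)) + (if even n then (t - (-1)) powr (- (1 / p)) else 0) + 1)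
      integrable_on {a..1}"
    using assms by (intro integrable_add powr_singularity_integrable) auto
  fix t assume t: "t \<in> {a..1}"
  have mono: "1 / (1 - t ^ n) powr (1 / p) \<le> d powr (- (1 / p))" if "0 < d" "d \<le> 1 - t ^ n" for d
    unfolding powr_minus_divide using that assms
    by (intro divide_left_mono powr_mono2) auto
  consider "1 - t ^ n = 0" | "1 - t ^ n \<noteq> 0" "t \<ge> 0" | "1 - t ^ n \<noteq> 0" "t < 0" "even n" | "t < 0" "odd n"
    by linarith
  then show "\<bar>1 / (1 - t ^ n) powr (1 / p)\<bar> \<le>
      (1 - t) powr (- (1 / p)) + (if even n then (t - (-1)) powr (- (1 / p)) else 0) + 1"
  proof cases
    case 1
    then show ?thesis by simp
  next
    case 2
    then have "t < 1" using t by (cases "t = 1") auto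
    moreover have "t ^ n \<le> t ^ 1" using 2 t assms by (intro power_decreasing) auto
    ultimately have "1 / (1 - t ^ n) powr (1 / p) \<le> (1 - t) powr (- (1 / p))" by (intro mono) auto
    then show ?thesis by (simp add: add_nonneg_nonneg add.assoc add_increasing2)
  next
    case 3
    then have "-1 < t" using t assms by (cases "t = -1") (auto simp: dom_F_def)
    moreover have "\<bar>t\<bar> ^ n \<le> \<bar>t\<bar> ^ 1" using 3 \<open>-1 < t\<close> assms by (intro power_decreasing) auto
    then have "t ^ n \<le> -t" using 3 by (simp add: power_even_abs)
    ultimately have "1 / (1 - t ^ n) powr (1 / p) \<le> (t - (-1)) powr (- (1 / p))" by (intro mono) auto
    then show ?thesis using 3 by (simp add: add_nonneg_nonneg add.assoc add_increasing add_increasing2)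
  next
    case 4
    then have "t ^ n < 0" by simp
    then have "1 / (1 - t ^ n) powr (1 / p) \<le> 1 powr (- (1 / p))" by (intro mono) linarith+
    then show ?thesis by (simp add: add_increasing)
  qed
qed

text \<open>Basing the integral at a point to the left of both \<open>0\<close> and \<open>y\<close> avoids the oriented integral,
  so that continuity and derivative follow from the facts about indefinite integrals.\<close>
lemma F_pn_eq_integral_diff:
  fixes a p y :: real
  assumes "p > 1" "n > 0" "a \<in> dom_F n" "a \<le> 0" "y \<in> {a..1}"
  defines "f \<equiv> \<lambda>t. 1 / (1 - t ^ n) powr (1 / p)"
  shows "F_pn p n y = integral {a..y} f - integral {a..0} f"
proof -
  have int: "set_integrable lborel {c..d} f" if "a \<le> c" "d \<le> 1" for c d
    using set_integrable_subset[OF F_integrand_integrable[OF assms(1-3)], of "{c..d}"] that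
    by (auto simp: f_def)
  have hk: "f integrable_on {c..d}" if "a \<le> c" "d \<le> 1" for c d
    using set_borel_integral_eq_integral(1)[OF int[OF that]] .
  show ?thesis
  proof (cases "y \<ge> 0")
    case True
    have "F_pn p n y = integral {0..y} f"
      unfolding F_pn_def f_def[symmetric] zero_ereal_def
      using assms(4,5) True by (subst interval_integral_eq_integral) (auto intro!: int)
    moreover have "integral {a..0} f + integral {0..y} f = integral {a..y} f"
      using assms True by (intro Henstock_Kurzweil_Integration.integral_combine hk) auto
    ultimately show ?thesis by simp
  next
    case False
    have "F_pn p n y = - integral {y..0} f"
      unfolding F_pn_def f_def[symmetric] zero_ereal_def
      using assms(4,5) False
      by (subst interval_integral_endpoints_reverse, subst interval_integral_eq_integral) (auto intro!: int)
    moreover have "integral {a..y} f + integral {y..0} f = integral {a..0} f"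
      using assms False by (intro Henstock_Kurzweil_Integration.integral_combine hk) auto
    ultimately show ?thesis by simp
  qed
qed

lemma F_pn_continuous_on:
  assumes "p > 1" "n > 0" "a \<in> dom_F n" "a \<le> 0"
  shows "continuous_on {a..1} (F_pn p n)"
proof -
  have "continuous_on {a..1} (\<lambda>y. integral {a..y} (\<lambda>t. 1 / (1 - t ^ n) powr (1 / p))
          - integral {a..0} (\<lambda>t. 1 / (1 - t ^ n) powr (1 / p)))"
    using set_borel_integral_eq_integral(1)[OF F_integrand_integrable[OF assms(1-3)]]
    by (intro continuous_intros indefinite_integral_continuous_1)
  then show ?thesis
    using assms by (subst continuous_on_cong[OF refl F_pn_eq_integral_diff[where a = a]]) auto
qed

lemma F_pn_has_derivative:
  fixes y :: real
  assumes "p > 1" "n > 0" "y < 1" "even n \<Longrightarrow> -1 < y"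
  shows "(F_pn p n has_real_derivative 1 / (1 - y ^ n) powr (1 / p)) (at y)"
proof -
  obtain a where a: "a \<in> dom_F n" "a \<le> 0" "a < y"
    by (rule that[of "if even n then -1 else min 0 (y - 1)"]) (use assms in \<open>auto simp: dom_F_def\<close>)
  obtain b where b: "y < b" "b < 1" using assms(3) dense by blast
  let ?f = "\<lambda>t. 1 / (1 - t ^ n) powr (1 / p)"
  have nz: "1 - t ^ n \<noteq> 0" if "a < t" "t < 1" for t
    using one_minus_power_pos[of n t] assms(2) a that by (auto simp: dom_F_def split: if_splits)
  have fint: "?f integrable_on {a..1}"
    by (rule set_borel_integral_eq_integral(1)[OF F_integrand_integrable[OF assms(1,2) a(1)]])
  define c where "c = (a + y) / 2"
  have c: "a < c" "c < y" using a by (auto simp: c_def)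
  have "((\<lambda>u. integral {c..u} ?f) has_vector_derivative ?f y) (at y within {c..b})"
    using b c nz by (intro integral_has_vector_derivative continuous_intros) fastforce+
  then have "((\<lambda>u. integral {c..u} ?f) has_real_derivative ?f y) (at y)"
    using b c by (simp add: has_real_derivative_iff_has_vector_derivative at_within_Icc_at)
  then have "((\<lambda>u. integral {c..u} ?f + (integral {a..c} ?f - integral {a..0} ?f))
      has_real_derivative ?f y) (at y)"
    by (auto intro!: derivative_eq_intros)
  then show ?thesis
  proof (rule has_field_derivative_transform_within_open[where S = "{c<..<b}"])
    fix u assume u: "u \<in> {c<..<b}"
    have "integral {a..c} ?f + integral {c..u} ?f = integral {a..u} ?f"
      using a b c u
      by (intro Henstock_Kurzweil_Integration.integral_combine integrable_on_subinterval[OF fint]) auto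
    then show "integral {c..u} ?f + (integral {a..c} ?f - integral {a..0} ?f) = F_pn p n u"
      using F_pn_eq_integral_diff[OF assms(1,2) a(1,2), of u] u c b by auto
  qed (use b c in auto)
qed

lemma F_pn_strict_mono_on:
  assumes "p > 1" "n > 0"
  shows "strict_mono_on (dom_F n) (F_pn p n)"
proof (rule strict_mono_onI)
  fix x y assume xy: "x \<in> dom_F n" "y \<in> dom_F n" "x < y"
  define a where "a = min 0 x"
  have a: "a \<in> dom_F n" "a \<le> 0" using xy by (auto simp: a_def dom_F_def min_def)
  show "F_pn p n x < F_pn p n y"
  proof (rule DERIV_pos_imp_increasing_open[OF xy(3)])
    show "continuous_on {x..y} (F_pn p n)"
      by (rule continuous_on_subset[OF F_pn_continuous_on[OF assms a]])
         (use xy in \<open>auto simp: a_def dom_F_def split: if_splits\<close>)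
    fix t assume t: "x < t" "t < y"
    then have *: "t < 1" "even n \<Longrightarrow> -1 < t" using xy by (auto simp: dom_F_def split: if_splits)
    then have "0 < 1 / (1 - t ^ n) powr (1 / p)"
      using one_minus_power_pos[OF assms(2) *] by simp
    then show "\<exists>D. (F_pn p n has_real_derivative D) (at t) \<and> 0 < D"
      using F_pn_has_derivative[OF assms *] by blast
  qed
qed

lemma F_pn_0 [simp]: "F_pn p n 0 = 0"
  by (simp add: F_pn_def flip: zero_ereal_def)

lemma pi_pn_pos:
  assumes "p > 1" "n > 0"
  shows "0 < pi_pn p n"
  using strict_mono_onD[OF F_pn_strict_mono_on[OF assms], of 0 1]
  by (simp add: pi_pn_def dom_F_def)

lemma sin_pn_F_pn:
  assumes "p > 1" "n > 0" "y \<in> dom_F n"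
  shows "sin_pn p n (F_pn p n y) = y"
  unfolding sin_pn_def
  using assms by (intro inv_into_f_f strict_mono_on_imp_inj_on F_pn_strict_mono_on)

text \<open>By monotonicity the limit that bounds the domain for odd \<open>n\<close> exists and is the infimum of
  the values.\<close>
lemma F_minf_le:
  assumes "p > 1" "odd n" "y \<le> 1"
  shows "F_minf p n \<le> ereal (F_pn p n y)"
proof -
  have n: "n > 0" using assms(2) by (cases n) auto
  have mono: "F_pn p n u \<le> F_pn p n v" if "u \<le> v" "v \<le> 1" for u v
    using strict_mono_onD[OF F_pn_strict_mono_on[OF assms(1) n], of u v] that assms(2)
    by (cases "u = v") (auto simp: dom_F_def)
  define L where "L = (INF u\<in>{..1}. ereal (F_pn p n u))"
  have "((\<lambda>u. ereal (F_pn p n u)) \<longlongrightarrow> L) at_bot"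
  proof (rule order_tendstoI)
    fix l assume "l < L"
    then have "l < ereal (F_pn p n u)" if "u \<le> 1" for u
      using that unfolding L_def by (meson INF_lower atMost_iff less_le_trans)
    then show "eventually (\<lambda>u. l < ereal (F_pn p n u)) at_bot"
      by (auto simp: eventually_at_bot_linorder)
  next
    fix l assume "L < l"
    then obtain v where v: "v \<le> 1" "ereal (F_pn p n v) < l"
      unfolding L_def by (auto simp: INF_less_iff)
    then have "ereal (F_pn p n u) < l" if "u \<le> v" for u
      using mono[OF that v(1)] by (meson ereal_less_eq(3) le_less_trans)
    then show "eventually (\<lambda>u. ereal (F_pn p n u) < l) at_bot"
      by (auto simp: eventually_at_bot_linorder)
  qed
  then have "F_minf p n = L" unfolding F_minf_def by (intro tendsto_Lim) auto
  then show ?thesis using assms(3) by (auto simp: L_def intro: INF_lower)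
qed

text \<open>Close to \<open>pi_pn p n / 2\<close> the generalized sine takes the values that the intermediate value
  theorem finds on \<open>[0, 1]\<close>, for even and odd \<open>n\<close> alike; all later arguments work on this common
  piece of the two kinds of domain.\<close>
lemma near_quarter_period:
  assumes "p > 1" "n > 0" "0 \<le> z" "z < pi_pn p n / 2"
  shows "pi_pn p n / 2 - z \<in> dom_sin p n"
    and "sin_pn p n (pi_pn p n / 2 - z) \<in> {0..1}"
    and "F_pn p n (sin_pn p n (pi_pn p n / 2 - z)) = pi_pn p n / 2 - z"
proof -
  have "F_minf p n < ereal (pi_pn p n / 2 - z)" if "odd n"
    using F_minf_le[OF assms(1) that, of 0] assms(4)
    by (simp add: le_less_trans flip: zero_ereal_def)
  then show "pi_pn p n / 2 - z \<in> dom_sin p n"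
    using assms by (auto simp: dom_sin_def)
  have "continuous_on {0..1} (F_pn p n)"
    by (rule F_pn_continuous_on) (use assms in \<open>auto simp: dom_F_def\<close>)
  then obtain y where y: "0 \<le> y" "y \<le> 1" "F_pn p n y = pi_pn p n / 2 - z"
    using IVT'[of "F_pn p n" 0 "pi_pn p n / 2 - z" 1] assms by (auto simp: pi_pn_def)
  moreover have "sin_pn p n (pi_pn p n / 2 - z) = y"
    using sin_pn_F_pn[OF assms(1,2), of y] y by (auto simp: dom_F_def)
  ultimately show "sin_pn p n (pi_pn p n / 2 - z) \<in> {0..1}"
    and "F_pn p n (sin_pn p n (pi_pn p n / 2 - z)) = pi_pn p n / 2 - z" by auto
qed

section \<open>Formal power series solving the polynomial system\<close>

lemma fps_power_nth_cong:
  fixes A B :: "'a::comm_ring_1 fps"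
  assumes "\<And>i. i \<le> k \<Longrightarrow> fps_nth A i = fps_nth B i"
  shows "fps_nth (A ^ j) k = fps_nth (B ^ j) k"
  using assms
proof (induction j arbitrary: k)
  case (Suc j)
  then show ?case by (auto simp: fps_mult_nth intro!: sum.cong)
qed auto

lemma fps_power_nth_nonneg:
  fixes A :: "real fps"
  assumes "\<And>i. i \<le> k \<Longrightarrow> 0 \<le> fps_nth A i"
  shows "0 \<le> fps_nth (A ^ j) k"
  using assms
proof (induction j arbitrary: k)
  case (Suc j)
  then show ?case by (auto simp: fps_mult_nth intro!: sum_nonneg mult_nonneg_nonneg)
qed (auto simp: fps_one_nth)

text \<open>Truncating a product discards some of the terms that the product of the truncations
  contains, and with nonnegative coefficients the discarded terms only lower the value.\<close>
lemma sum_fps_mult_le: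
  fixes A B :: "real fps"
  assumes "\<And>i. 0 \<le> fps_nth A i" "\<And>i. 0 \<le> fps_nth B i" "0 \<le> x"
  shows "(\<Sum>k\<le>N. fps_nth (A * B) k * x ^ k) \<le>
    (\<Sum>k\<le>N. fps_nth A k * x ^ k) * (\<Sum>k\<le>N. fps_nth B k * x ^ k)"
proof -
  let ?h = "\<lambda>(i, j). (fps_nth A i * x ^ i) * (fps_nth B j * x ^ j)"
  have "(\<Sum>k\<le>N. fps_nth (A * B) k * x ^ k) = (\<Sum>k\<le>N. \<Sum>i\<le>k. ?h (i, k - i))"
  proof (intro sum.cong refl)
    fix k
    have "x ^ k = x ^ i * x ^ (k - i)" if "i \<le> k" for i
      using that by (simp flip: power_add)
    then show "fps_nth (A * B) k * x ^ k = (\<Sum>i\<le>k. ?h (i, k - i))"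
      by (auto simp: fps_mult_nth sum_distrib_right atLeast0AtMost intro!: sum.cong)
  qed
  also have "\<dots> = sum ?h {(i, j). i + j \<le> N}"
    by (subst sum.triangle_reindex_eq[symmetric]) simp
  also have "\<dots> \<le> sum ?h ({..N} \<times> {..N})"
    using assms by (intro sum_mono2) (auto intro!: mult_nonneg_nonneg)
  also have "\<dots> = (\<Sum>k\<le>N. fps_nth A k * x ^ k) * (\<Sum>k\<le>N. fps_nth B k * x ^ k)"
    by (simp add: sum_product sum.cartesian_product)
  finally show ?thesis .
qed

lemma sum_fps_power_le:
  fixes A :: "real fps"
  assumes "\<And>i. 0 \<le> fps_nth A i" "0 \<le> x"
  shows "(\<Sum>k\<le>N. fps_nth (A ^ j) k * x ^ k) \<le> (\<Sum>k\<le>N. fps_nth A k * x ^ k) ^ j"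
proof (induction j)
  case 0
  have "(\<Sum>k\<le>N. fps_nth (1 :: real fps) k * x ^ k) = (\<Sum>k\<le>N. if k = 0 then 1 else 0)"
    by (intro sum.cong) (auto simp: fps_one_nth)
  also have "\<dots> = 1" by (subst sum.delta) auto
  finally show ?case by simp
next
  case (Suc j)
  have "(\<Sum>k\<le>N. fps_nth (A ^ Suc j) k * x ^ k) \<le>
      (\<Sum>k\<le>N. fps_nth A k * x ^ k) * (\<Sum>k\<le>N. fps_nth (A ^ j) k * x ^ k)"
    unfolding power_Suc using assms by (intro sum_fps_mult_le fps_power_nth_nonneg) auto
  also have "\<dots> \<le> (\<Sum>k\<le>N. fps_nth A k * x ^ k) * (\<Sum>k\<le>N. fps_nth A k * x ^ k) ^ j"
    using assms Suc by (intro mult_left_mono sum_nonneg mult_nonneg_nonneg) auto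
  finally show ?case by simp
qed

text \<open>If every coefficient of \<open>T A\<close> depends only on earlier coefficients of \<open>A\<close>, then the
  coefficients of the iterates \<open>(T ^^ j) 0\<close> become stationary, the \<open>k\<close>-th one from \<open>j = k + 1\<close> on.
  This is how recursively specified power series are obtained below.\<close>
lemma causal_fps_fixpoint:
  fixes T :: "'a::zero fps \<Rightarrow> 'a fps"
  assumes "\<And>A B k. (\<And>i. i < k \<Longrightarrow> fps_nth A i = fps_nth B i) \<Longrightarrow> fps_nth (T A) k = fps_nth (T B) k"
  shows "\<exists>A. T A = A"
proof -
  define a where "a j = (T ^^ j) 0" for j
  have stable: "fps_nth (a i) k = fps_nth (a j) k" if "k < i" "k < j" for i j k
    using that
  proof (induction k arbitrary: i j rule: less_induct)
    case (less k)
    obtain i' j' where ij: "i = Suc i'" "j = Suc j'"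
      using less.prems by (cases i; cases j) auto
    have "fps_nth (T (a i')) k = fps_nth (T (a j')) k"
      by (rule assms, rule less.IH) (use less.prems ij in auto)
    then show ?case by (simp add: a_def ij)
  qed
  define A where "A = Abs_fps (\<lambda>k. fps_nth (a (Suc k)) k)"
  have "fps_nth (T A) k = fps_nth A k" for k
  proof -
    have "fps_nth A i = fps_nth (a k) i" if "i < k" for i
      using stable[of i "Suc i" k] that by (simp add: A_def)
    then have "fps_nth (T A) k = fps_nth (T (a k)) k" by (rule assms)
    then show ?thesis by (simp add: A_def a_def)
  qed
  then show ?thesis by (auto simp: fps_eq_iff)
qed

text \<open>The recurrences say that \<open>A z = P (e * z ^ m)\<close> and \<open>B z = z * Q (e * z ^ m)\<close> solve
  \<open>A' = e * B ^ (m - 1)\<close>, \<open>B' = (n / m) * A ^ (n - 1)\<close>, \<open>A 0 = 1\<close>, \<open>B 0 = 0\<close>, whatever the constant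
  \<open>e\<close> is. Writing the solution in terms of \<open>z ^ m\<close> puts the symmetry of the system under rotation by
  \<open>m\<close>-th roots of unity into the shape of the series, and a change of the sign \<open>e\<close> is then just a
  change of the argument of the same two series.\<close>
locale polynomial_system =
  fixes m n :: nat and P Q :: "real fps"
  assumes m: "m \<ge> 2" and n: "n \<ge> 2"
    and P_0: "fps_nth P 0 = 1"
    and P_Suc: "\<And>k. real m * real (Suc k) * fps_nth P (Suc k) = fps_nth (Q ^ (m - 1)) k"
    and Q_nth: "\<And>k. (1 + real m * real k) * fps_nth Q k = real n / real m * fps_nth (P ^ (n - 1)) k"

lemma polynomial_system_exists:
  assumes "m \<ge> 2" "n \<ge> 2"
  obtains P Q where "polynomial_system m n P Q"
proof -
  define QQ :: "real fps \<Rightarrow> real fps" where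
    "QQ A = Abs_fps (\<lambda>k. real n / real m * fps_nth (A ^ (n - 1)) k / (1 + real m * real k))" for A
  define T where "T A = Abs_fps (\<lambda>k. case k of 0 \<Rightarrow> 1
      | Suc j \<Rightarrow> fps_nth (QQ A ^ (m - 1)) j / (real m * real (Suc j)))" for A
  have "\<exists>P. T P = P"
  proof (rule causal_fps_fixpoint)
    fix A B :: "real fps" and k
    assume AB: "\<And>i. i < k \<Longrightarrow> fps_nth A i = fps_nth B i"
    show "fps_nth (T A) k = fps_nth (T B) k"
    proof (cases k)
      case (Suc j)
      have "fps_nth (QQ A) i = fps_nth (QQ B) i" if "i \<le> j" for i
        using fps_power_nth_cong[of i A B "n - 1"] AB that Suc by (simp add: QQ_def)
      then have "fps_nth (QQ A ^ (m - 1)) j = fps_nth (QQ B ^ (m - 1)) j"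
        by (rule fps_power_nth_cong)
      then show ?thesis by (simp add: T_def Suc)
    qed (simp add: T_def)
  qed
  then obtain P where P: "T P = P" by blast
  show thesis
  proof (rule that, unfold_locales)
    show "fps_nth P 0 = 1" by (subst P[symmetric]) (simp add: T_def)
    have "fps_nth P (Suc k) = fps_nth (QQ P ^ (m - 1)) k / (real m * real (Suc k))" for k
      by (subst P[symmetric]) (simp add: T_def)
    then show "real m * real (Suc k) * fps_nth P (Suc k) = fps_nth (QQ P ^ (m - 1)) k" for k
      using assms by (simp del: of_nat_Suc)
    have "1 + real m * real k > 0" for k by (intro add_pos_nonneg) auto
    then show "(1 + real m * real k) * fps_nth (QQ P) k = real n / real m * fps_nth (P ^ (n - 1)) k" for k
      by (simp add: QQ_def less_imp_neq[symmetric])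
  qed (use assms in auto)
qed

context polynomial_system
begin

lemma Q_nonneg_if: "(\<And>i. i \<le> k \<Longrightarrow> 0 \<le> fps_nth P i) \<Longrightarrow> 0 \<le> fps_nth Q k"
proof -
  assume "\<And>i. i \<le> k \<Longrightarrow> 0 \<le> fps_nth P i"
  then have "0 \<le> (1 + real m * real k) * fps_nth Q k"
    unfolding Q_nth by (intro mult_nonneg_nonneg fps_power_nth_nonneg) auto
  moreover have "1 + real m * real k > 0" by (intro add_pos_nonneg) auto
  ultimately show ?thesis by (simp add: zero_le_mult_iff)
qed

lemma P_nonneg: "0 \<le> fps_nth P k"
proof (induction k rule: less_induct)
  case (less k)
  show ?case
  proof (cases k)
    case (Suc j)
    have "0 \<le> fps_nth Q i" if "i \<le> j" for i
      using that less Suc by (intro Q_nonneg_if) auto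
    then have "0 \<le> real m * real (Suc j) * fps_nth P (Suc j)"
      unfolding P_Suc by (intro fps_power_nth_nonneg)
    moreover have "0 < real m * real (Suc j)" using m by simp
    ultimately show ?thesis unfolding Suc by (simp add: zero_le_mult_iff)
  qed (simp add: P_0)
qed

lemma Q_nonneg: "0 \<le> fps_nth Q k"
  by (intro Q_nonneg_if P_nonneg)

lemma Q_0: "fps_nth Q 0 = real n / real m"
  using Q_nth[of 0] P_0 by (simp add: fps_power_zeroth)

lemma P_1_pos: "0 < fps_nth P 1"
proof -
  have "real m * fps_nth P 1 = (real n / real m) ^ (m - 1)"
    using P_Suc[of 0] Q_0 by (simp add: fps_power_zeroth)
  moreover have "0 < (real n / real m) ^ (m - 1)" using m n by simp
  ultimately have "0 < real m * fps_nth P 1" by (simp only:)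
  then show ?thesis using m by (simp add: zero_less_mult_iff)
qed

text \<open>The recurrence bounds the coefficients of \<open>Q\<close> by those of a multiple of \<open>P ^ (n - 1)\<close>.\<close>
lemma fps_conv_radius_Q: "fps_conv_radius P \<le> fps_conv_radius Q"
proof -
  have "fps_nth Q k \<le> real n / real m * fps_nth (P ^ (n - 1)) k" for k
  proof -
    have "0 \<le> real m * real k * fps_nth Q k" using Q_nonneg by simp
    then show ?thesis unfolding Q_nth[symmetric] by (simp add: algebra_simps)
  qed
  note Q_le = this
  have bound: "norm (fps_nth Q k * r ^ k) \<le> real n / real m * (fps_nth (P ^ (n - 1)) k * r ^ k)"
    if "0 < r" for k and r :: real
  proof -
    have "fps_nth Q k * r ^ k \<le> (real n / real m * fps_nth (P ^ (n - 1)) k) * r ^ k"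
      using that by (intro mult_right_mono Q_le) auto
    then show ?thesis using that Q_nonneg[of k] by (simp only: abs_mult real_norm_def mult.assoc abs_of_nonneg zero_le_power less_imp_le)
  qed
  show ?thesis
    unfolding fps_conv_radius_def[of Q]
  proof (rule conv_radius_geI_ex')
    fix r :: real assume r: "0 < r" "ereal r < fps_conv_radius P"
    then have "summable (\<lambda>k. fps_nth (P ^ (n - 1)) k * r ^ k)"
      using fps_conv_radius_power[of P "n - 1"] by (intro summable_fps) (auto intro: less_le_trans)
    then have "summable (\<lambda>k. real n / real m * (fps_nth (P ^ (n - 1)) k * r ^ k))"
      by (rule summable_mult)
    then have "summable (\<lambda>k. fps_nth Q k * r ^ k)"
      by (rule summable_comparison_test'[where N = 0]) (rule bound[OF r(1)])
    then show "summable (\<lambda>k. fps_nth Q k * of_real r ^ k)" by simp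
  qed
qed

text \<open>The recurrences for the coefficients are the identities
  \<open>m * P' = Q ^ (m - 1)\<close> and \<open>Q + m * X * Q' = (n / m) * P ^ (n - 1)\<close>; the rest is the chain rule.\<close>
lemma derivative_system:
  fixes e z :: real
  assumes "ereal (\<bar>e * z ^ m\<bar>) < fps_conv_radius P"
  shows "((\<lambda>z. eval_fps P (e * z ^ m)) has_real_derivative
           e * (z * eval_fps Q (e * z ^ m)) ^ (m - 1)) (at z)"
    and "((\<lambda>z. z * eval_fps Q (e * z ^ m)) has_real_derivative
           real n / real m * eval_fps P (e * z ^ m) ^ (n - 1)) (at z)"
proof -
  let ?x = "e * z ^ m"
  have P: "ereal (norm ?x) < fps_conv_radius P" using assms by simp
  then have Q: "ereal (norm ?x) < fps_conv_radius Q"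
    using fps_conv_radius_Q less_le_trans by blast
  have dQ: "ereal (norm ?x) < fps_conv_radius (fps_deriv Q)"
    using Q fps_conv_radius_deriv less_le_trans by blast
  have dP: "ereal (norm ?x) < fps_conv_radius (fps_deriv P)"
    using P fps_conv_radius_deriv less_le_trans by blast
  have Pder: "fps_const (real m) * fps_deriv P = Q ^ (m - 1)"
    by (rule fps_ext) (use P_Suc in \<open>simp add: mult_ac\<close>)
  then have "eval_fps (fps_const (real m) * fps_deriv P) ?x = eval_fps (Q ^ (m - 1)) ?x" by simp
  then have evP: "real m * eval_fps (fps_deriv P) ?x = eval_fps Q ?x ^ (m - 1)"
    using Q dP by (simp add: eval_fps_mult eval_fps_power)
  have "Q + fps_const (real m) * (fps_X * fps_deriv Q) = fps_const (real n / real m) * P ^ (n - 1)"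
  proof (rule fps_ext)
    fix k show "fps_nth (Q + fps_const (real m) * (fps_X * fps_deriv Q)) k =
        fps_nth (fps_const (real n / real m) * P ^ (n - 1)) k"
      using Q_nth[of k] by (cases k) (simp_all add: algebra_simps)
  qed
  then have "eval_fps (Q + fps_const (real m) * (fps_X * fps_deriv Q)) ?x =
      eval_fps (fps_const (real n / real m) * P ^ (n - 1)) ?x" by simp
  moreover have "ereal (norm ?x) < fps_conv_radius (fps_X * fps_deriv Q)"
    using dQ fps_conv_radius_mult[of fps_X "fps_deriv Q"] by (auto intro: less_le_trans)
  moreover have "ereal (norm ?x) < fps_conv_radius (fps_const (real m) * (fps_X * fps_deriv Q))"
    using calculation(2) m by (simp add: fps_conv_radius_cmult_left)
  moreover have "ereal (norm ?x) < fps_conv_radius (P ^ (n - 1))"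
    using P fps_conv_radius_power[of P "n - 1"] by (auto intro: less_le_trans)
  ultimately have evQ: "eval_fps Q ?x + real m * (?x * eval_fps (fps_deriv Q) ?x) =
      real n / real m * eval_fps P ?x ^ (n - 1)"
    using P Q dQ by (simp add: eval_fps_add eval_fps_mult eval_fps_power)
  have dx: "((\<lambda>z. e * z ^ m) has_real_derivative e * (real m * z ^ (m - 1))) (at z)"
    by (auto intro!: derivative_eq_intros)
  have P': "((\<lambda>z. eval_fps P (e * z ^ m)) has_real_derivative
      eval_fps (fps_deriv P) ?x * (e * (real m * z ^ (m - 1)))) (at z)"
    by (rule DERIV_chain2[OF has_field_derivative_eval_fps[OF P] dx])
  then show "((\<lambda>z. eval_fps P (e * z ^ m)) has_real_derivative
      e * (z * eval_fps Q ?x) ^ (m - 1)) (at z)"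
    by (simp add: power_mult_distrib mult_ac evP[symmetric] del: One_nat_def)
  have "((\<lambda>z. eval_fps Q (e * z ^ m)) has_real_derivative
      eval_fps (fps_deriv Q) ?x * (e * (real m * z ^ (m - 1)))) (at z)"
    by (rule DERIV_chain2[OF has_field_derivative_eval_fps[OF Q] dx])
  from DERIV_mult[OF DERIV_ident this]
  have Q': "((\<lambda>z. z * eval_fps Q (e * z ^ m)) has_real_derivative
      eval_fps Q ?x + (eval_fps (fps_deriv Q) ?x * (e * (real m * z ^ (m - 1)))) * z) (at z)"
    by (simp only: mult_1)
  have zm: "z ^ m = z ^ (m - 1) * z" using m by (simp add: power_eq_if)
  have eq: "(eval_fps (fps_deriv Q) ?x * (e * (real m * z ^ (m - 1)))) * z =
      real m * (?x * eval_fps (fps_deriv Q) ?x)"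
    unfolding zm by (simp only: mult_ac)
  show "((\<lambda>z. z * eval_fps Q (e * z ^ m)) has_real_derivative
      real n / real m * eval_fps P ?x ^ (n - 1)) (at z)"
    using Q' by (simp only: eq evQ)
qed

text \<open>The system is Hamiltonian: along a solution the derivative of \<open>A ^ n - e * B ^ m\<close> is
  \<open>n * A ^ (n - 1) * e * B ^ (m - 1) - e * m * B ^ (m - 1) * (n / m) * A ^ (n - 1) = 0\<close>. With
  \<open>1 / p = (m - 1) / m\<close> this turns the first equation into \<open>A' = - (1 - A ^ n) powr (1 / p)\<close> for
  \<open>e = - 1\<close>, and into \<open>A' = (A ^ n - 1) powr (1 / p)\<close> for \<open>e = 1\<close>.\<close>
lemma first_integral:
  fixes e z :: real
  assumes "ereal (\<bar>e * z ^ m\<bar>) < fps_conv_radius P" "0 \<le> z"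
  shows "eval_fps P (e * z ^ m) ^ n - e * (z * eval_fps Q (e * z ^ m)) ^ m = 1"
proof (cases "z = 0")
  case True
  then show ?thesis using m P_0 by (simp add: eval_fps_at_0 power_0_left)
next
  case False
  define A where "A z = eval_fps P (e * z ^ m)" for z
  define B where "B z = z * eval_fps Q (e * z ^ m)" for z
  have D: "((\<lambda>z. A z ^ n - e * B z ^ m) has_real_derivative 0) (at t)" if "0 \<le> t" "t \<le> z" for t
  proof -
    have "\<bar>e * t ^ m\<bar> \<le> \<bar>e * z ^ m\<bar>"
      using that by (auto simp: abs_mult intro!: mult_left_mono power_mono)
    then have *: "ereal (\<bar>e * t ^ m\<bar>) < fps_conv_radius P"
      using assms(1) by (meson ereal_less_eq(3) le_less_trans)
    have "(A has_real_derivative e * B t ^ (m - 1)) (at t)"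
      and "(B has_real_derivative real n / real m * A t ^ (n - 1)) (at t)"
      using derivative_system[OF *] by (simp_all add: A_def[abs_def] B_def[abs_def])
    note [derivative_intros] = this
    show ?thesis
      by (rule derivative_eq_intros refl)+ (use m in simp)
  qed
  have "A z ^ n - e * B z ^ m = A 0 ^ n - e * B 0 ^ m"
  proof (rule DERIV_isconst_end[of 0 z "\<lambda>z. A z ^ n - e * B z ^ m"])
    show "continuous_on {0..z} (\<lambda>z. A z ^ n - e * B z ^ m)"
      by (intro continuous_at_imp_continuous_on ballI DERIV_isCont[OF D]) auto
    show "0 < z" using False assms(2) by simp
  qed (intro D, auto)
  also have "\<dots> = 1" using m P_0 by (simp add: A_def B_def eval_fps_at_0 power_0_left)
  finally show ?thesis by (simp add: A_def B_def)
qed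

end

section \<open>The blow-up time of the growing solution\<close>

text \<open>With \<open>a = (m - 1) / m\<close>, the time that the solution for \<open>e = 1\<close> takes to grow from \<open>1\<close> to \<open>y\<close>;
  its limit at infinity is the time of blow-up, \<open>mu m n\<close>.\<close>
definition Phi :: "real \<Rightarrow> nat \<Rightarrow> real \<Rightarrow> real" where
  "Phi a n y = integral {1..y} (\<lambda>t. 1 / (t ^ n - 1) powr a)"

lemma Phi_1 [simp]: "Phi a n 1 = 0"
  by (simp add: Phi_def)

context
  fixes a :: real and n :: nat
  assumes a: "0 < a" "a < 1" and n: "n > 0"
begin

lemma Phi_integrand_integrable: "(\<lambda>t. 1 / (t ^ n - 1) powr a) integrable_on {1..y}"
proof (rule set_borel_integral_eq_integral(1), rule set_integrable_lborel_comparison)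
  show "(\<lambda>t. 1 / (t ^ n - 1) powr a) \<in> borel_measurable borel" by measurable
  show "(\<lambda>t. (t - 1) powr (-a)) integrable_on {1..y}"
    by (rule powr_singularity_integrable(2)[OF a])
  fix t assume "t \<in> {1..y}"
  then consider "t = 1" | "t > 1" by fastforce
  then show "\<bar>1 / (t ^ n - 1) powr a\<bar> \<le> (t - 1) powr (-a)"
  proof cases
    case 2
    then have "t ^ 1 \<le> t ^ n" using n by (intro power_increasing) auto
    then show ?thesis
      using 2 a unfolding powr_minus_divide by (auto intro!: divide_left_mono powr_mono2)
  qed simp
qed

lemma Phi_continuous_on: "continuous_on {1..y} (Phi a n)"
  unfolding Phi_def[abs_def] by (rule indefinite_integral_continuous_1[OF Phi_integrand_integrable])

lemma Phi_has_derivative: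
  assumes "1 < y"
  shows "(Phi a n has_real_derivative 1 / (y ^ n - 1) powr a) (at y)"
proof -
  let ?f = "\<lambda>t. 1 / (t ^ n - 1) powr a"
  define c where "c = (1 + y) / 2"
  have c: "1 < c" "c < y" using assms by (auto simp: c_def)
  have nz: "t ^ n - 1 \<noteq> 0" if "1 < t" for t :: real
    using one_less_power[OF that n] by simp
  have "((\<lambda>u. integral {c..u} ?f) has_vector_derivative ?f y) (at y within {c..y+1})"
    using c nz by (intro integral_has_vector_derivative continuous_intros) fastforce+
  then have "((\<lambda>u. integral {c..u} ?f) has_real_derivative ?f y) (at y)"
    using c by (simp add: has_real_derivative_iff_has_vector_derivative at_within_Icc_at)
  then have "((\<lambda>u. integral {c..u} ?f + integral {1..c} ?f) has_real_derivative ?f y) (at y)"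
    by (auto intro!: derivative_eq_intros)
  then show ?thesis
  proof (rule has_field_derivative_transform_within_open[where S = "{c<..<y+1}"])
    fix u assume u: "u \<in> {c<..<y+1}"
    have "integral {1..c} ?f + integral {c..u} ?f = integral {1..u} ?f"
      using c u by (intro Henstock_Kurzweil_Integration.integral_combine Phi_integrand_integrable) auto
    then show "integral {c..u} ?f + integral {1..c} ?f = Phi a n u"
      by (simp add: Phi_def)
  qed (use c in auto)
qed

lemma Phi_strict_mono:
  assumes "1 \<le> x" "x < y"
  shows "Phi a n x < Phi a n y"
proof (rule DERIV_pos_imp_increasing_open[OF assms(2)])
  show "continuous_on {x..y} (Phi a n)"
    by (rule continuous_on_subset[OF Phi_continuous_on[of y]]) (use assms in auto)
  fix t assume "x < t" "t < y"
  then have t: "1 < t" using assms by simp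
  have "0 < 1 / (t ^ n - 1) powr a" using one_less_power[OF t n] by simp
  then show "\<exists>D. (Phi a n has_real_derivative D) (at t) \<and> 0 < D"
    using Phi_has_derivative[OF t] by blast
qed

lemma Phi_nonneg: "1 \<le> y \<Longrightarrow> 0 \<le> Phi a n y"
  using Phi_strict_mono[of 1 y] by (cases "y = 1") auto

lemma power_superadditive: "0 \<le> x \<Longrightarrow> x ^ n + 1 \<le> (x + 1) ^ n" for x :: real
  using n
proof (induction n rule: nat_induct_non_zero)
  case (Suc k)
  have "x ^ Suc k + 1 \<le> (x ^ k + 1) * (x + 1)" using Suc.prems by (simp add: algebra_simps)
  also have "\<dots> \<le> (x + 1) ^ Suc k" using Suc by (simp add: mult.commute mult_left_mono)
  finally show ?case .
qed simp

text \<open>Beyond \<open>2\<close> the integrand is at most \<open>(t - 1) powr (- a * n)\<close>, whose exponent is less than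
  \<open>- 1\<close>.\<close>
lemma Phi_bounded:
  assumes an: "1 < a * real n" and "1 \<le> y"
  shows "Phi a n y \<le> Phi a n 2 + 1 / (a * real n - 1)"
proof (cases "y \<le> 2")
  case True
  then have "Phi a n y \<le> Phi a n 2"
    using Phi_strict_mono[of y 2] assms by (cases "y = 2") auto
  then show ?thesis using an by (simp add: add_increasing2)
next
  case False
  define b where "b = a * real n"
  have b: "b > 1" using an by (simp add: b_def)
  define g where "g t = Phi a n t + (t - 1) powr (1 - b) / (b - 1)" for t
  have "g y \<le> g 2"
  proof (rule DERIV_nonpos_imp_nonincreasing[of 2 y g])
    fix t :: real assume t: "2 \<le> t" "t \<le> y"
    have "(g has_real_derivative 1 / (t ^ n - 1) powr a
        + (1 - b) * (t - 1) powr (1 - b - 1) / (b - 1)) (at t)"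
      unfolding g_def[abs_def] using t b
      by (auto intro!: derivative_eq_intros Phi_has_derivative)
    also have "(1 - b) * (t - 1) powr (1 - b - 1) / (b - 1) = - ((t - 1) powr (-b))"
      using b by (simp add: field_simps)
    finally have D: "(g has_real_derivative 1 / (t ^ n - 1) powr a + - ((t - 1) powr (-b))) (at t)" .
    have "(t - 1) powr (-b) = 1 / ((t - 1) ^ n) powr a"
      using t by (simp add: powr_minus_divide b_def powr_powr powr_realpow[symmetric] mult.commute)
    moreover have "0 < (t - 1) ^ n" "0 < t ^ n - 1"
      using t one_less_power[of t n] n by auto
    then have "1 / (t ^ n - 1) powr a \<le> 1 / ((t - 1) ^ n) powr a"
      using power_superadditive[of "t - 1"] t a by (intro divide_left_mono powr_mono2) auto
    ultimately show "\<exists>D. (g has_real_derivative D) (at t) \<and> D \<le> 0"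
      using D by (intro exI[of _ "1 / (t ^ n - 1) powr a + - ((t - 1) powr (-b))"]) auto
  qed (use False in auto)
  then have "Phi a n y + (y - 1) powr (1 - b) / (b - 1) \<le> Phi a n 2 + 1 / (b - 1)"
    by (simp add: g_def)
  moreover have "0 \<le> (y - 1) powr (1 - b) / (b - 1)" using b by simp
  ultimately show ?thesis by (simp add: b_def)
qed

text \<open>As \<open>Phi\<close> is increasing and bounded, it converges at infinity, and the fundamental theorem for
  nonnegative integrands then yields that the improper integral exists and equals the supremum,
  which is not attained.\<close>
lemma improper_integral_eq_limit_of_Phi:
  assumes an: "1 < a * real n"
  defines "L \<equiv> LBINT t=1..\<infinity>. 1 / (t ^ n - 1) powr a"
  shows "1 \<le> y \<Longrightarrow> Phi a n y < L" and "r < L \<Longrightarrow> \<exists>y\<ge>1. r < Phi a n y"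
proof -
  define S where "S = (SUP y\<in>{1..}. Phi a n y)"
  have bdd: "bdd_above (Phi a n ` {1..})"
    using Phi_bounded[OF an] by (auto intro!: bdd_aboveI)
  have le_S: "Phi a n y \<le> S" if "1 \<le> y" for y
    unfolding S_def using bdd that by (intro cSUP_upper) auto
  have approx: "\<exists>y\<ge>1. r < Phi a n y" if "r < S" for r
    using that bdd unfolding S_def by (subst (asm) less_cSUP_iff) auto
  have "(Phi a n \<longlongrightarrow> S) at_top"
  proof (rule order_tendstoI)
    fix r assume "r < S"
    then obtain y where y: "y \<ge> 1" "r < Phi a n y" using approx by blast
    have "r < Phi a n u" if "y \<le> u" for u
      using Phi_strict_mono[of y u] y that by (cases "y = u") auto
    then show "eventually (\<lambda>u. r < Phi a n u) at_top"
      by (auto simp: eventually_at_top_linorder)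
  next
    fix r assume "S < r"
    then show "eventually (\<lambda>u. Phi a n u < r) at_top"
      using le_S by (auto simp: eventually_at_top_linorder intro!: exI[of _ 1] intro: le_less_trans)
  qed
  moreover have "(Phi a n \<longlongrightarrow> 0) (at_right 1)"
    using Phi_continuous_on[of 2] unfolding continuous_on_def
    by (metis Phi_1 at_within_Icc_at_right atLeastAtMost_iff one_le_numeral one_less_numeral_iff order_refl semiring_norm(76))
  ultimately have "L = S - 0"
    unfolding L_def
  proof (intro interval_integral_FTC_nonneg(2))
    fix x assume "1 < ereal x" "ereal x < \<infinity>"
    then have x: "1 < x" by simp
    then show "(Phi a n has_real_derivative 1 / (x ^ n - 1) powr a) (at x)"
      by (rule Phi_has_derivative)
    show "isCont (\<lambda>t. 1 / (t ^ n - 1) powr a) x"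
      using one_less_power[OF x n] by (intro continuous_intros) auto
  qed (auto simp: one_ereal_def ereal_tendsto_simps)
  then have L: "L = S" by simp
  show "r < L \<Longrightarrow> \<exists>y\<ge>1. r < Phi a n y" using approx L by simp
  show "Phi a n y < L" if "1 \<le> y"
    using Phi_strict_mono[of y "y + 1"] le_S[of "y + 1"] that L by simp
qed

end

section \<open>The radius of convergence of the solution\<close>

lemma eval_fps_ge_nth_0:
  fixes A :: "real fps"
  assumes "\<And>k. 0 \<le> fps_nth A k" "0 \<le> x" "ereal x < fps_conv_radius A"
  shows "fps_nth A 0 \<le> eval_fps A x"
proof -
  have "summable (\<lambda>k. fps_nth A k * x ^ k)" using assms by (intro summable_fps) auto
  then have "(\<Sum>k\<in>{0}. fps_nth A k * x ^ k) \<le> eval_fps A x"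
    unfolding eval_fps_def using assms by (intro sum_le_suminf) auto
  then show ?thesis by simp
qed

context polynomial_system
begin

abbreviation expo :: real where "expo \<equiv> (real m - 1) / real m"

lemma expo: "0 < expo" "expo < 1"
  using m by (auto simp: field_simps)

lemma n_pos: "n > 0" using n by simp

lemma power_powr_expo:
  assumes "0 < x"
  shows "(x ^ m) powr expo = x ^ (m - 1)"
proof -
  have "(x ^ m) powr expo = x powr (real (m - 1))"
    using assms m by (simp add: powr_powr of_nat_diff flip: powr_realpow)
  then show ?thesis using assms by (simp add: powr_realpow)
qed

text \<open>The truncations of the solution stay below the true trajectory. Let \<open>Y\<^sub>N\<close> and \<open>V\<^sub>N\<close> be the
  truncations of \<open>A\<close> and \<open>B\<close> for \<open>e = 1\<close>. Because the coefficients are nonnegative,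
  \<open>V\<^sub>N' \<le> (n / m) * Y\<^sub>N ^ (n - 1)\<close> and \<open>Y\<^sub>N\<^sub>+\<^sub>1' \<le> V\<^sub>N ^ (m - 1)\<close>, so that \<open>Y\<^sub>N \<le> A\<close> implies \<open>V\<^sub>N \<le> B\<close>,
  which implies \<open>Y\<^sub>N\<^sub>+\<^sub>1 \<le> A\<close>. The true trajectory is parametrized by its value \<open>y\<close>: at time
  \<open>Phi expo n y\<close> the two components are \<open>y\<close> and \<open>(y ^ n - 1) powr (1 / m)\<close>. In this way neither an
  inverse function nor the convergence of the series is presupposed.\<close>
lemma partial_sums_le:
  assumes "1 \<le> y"
  shows "(\<Sum>k\<le>N. fps_nth P k * (Phi expo n y ^ m) ^ k) \<le> y"
  using assms
proof (induction N arbitrary: y)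
  case 0
  then show ?case by (simp add: P_0)
next
  case (Suc N)
  define Y where "Y s = (\<Sum>k\<le>N. fps_nth P k * (s ^ m) ^ k)" for s
  define q where "q s = (\<Sum>k\<le>N. fps_nth Q k * (s ^ m) ^ k)" for s
  define Y' where "Y' s = (\<Sum>k\<le>Suc N. fps_nth P k * (s ^ m) ^ k)" for s
  have Y_nonneg: "0 \<le> Y s" and q_nonneg: "0 \<le> q s" if "0 \<le> s" for s
    unfolding Y_def q_def using that P_nonneg Q_nonneg by (auto intro!: sum_nonneg)
  have \<Phi>_nonneg: "0 \<le> Phi expo n t" if "1 \<le> t" for t
    using Phi_nonneg[OF expo n_pos that] .
  have V_le: "Phi expo n t * q (Phi expo n t) \<le> (t ^ n - 1) powr (1 / real m)" if "1 \<le> t" for t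
  proof -
    define h where "h t = (t ^ n - 1) powr (1 / real m) - Phi expo n t * q (Phi expo n t)" for t
    have "h 1 \<le> h t"
    proof (rule DERIV_nonneg_imp_increasing_open[OF that])
      show "continuous_on {1..t} h"
        unfolding h_def[abs_def] q_def using m
        by (intro continuous_intros continuous_on_powr' Phi_continuous_on[OF expo n_pos])
           (auto intro: one_le_power)
      fix u assume u: "1 < u" "u < t"
      define s where "s = Phi expo n u"
      have s: "0 \<le> s" using \<Phi>_nonneg[of u] u by (simp add: s_def)
      have un: "0 < u ^ n - 1" using one_less_power[OF u(1) n_pos] by simp
      define d where "d = 1 / (u ^ n - 1) powr expo"
      have d: "0 \<le> d" by (simp add: d_def)
      have \<Phi>': "(Phi expo n has_real_derivative d) (at u)"
        unfolding d_def by (rule Phi_has_derivative[OF expo n_pos u(1)])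
      have dV: "((\<lambda>s. s * q s) has_real_derivative real n / real m *
          (\<Sum>k\<le>N. fps_nth (P ^ (n - 1)) k * (s ^ m) ^ k)) (at s)"
      proof -
        have eq: "(\<lambda>s. s * q s) = (\<lambda>s. \<Sum>k\<le>N. fps_nth Q k * s ^ Suc (m * k))"
          unfolding q_def sum_distrib_left power_Suc power_mult by (simp only: mult_ac)
        have "((\<lambda>s. \<Sum>k\<le>N. fps_nth Q k * s ^ Suc (m * k)) has_real_derivative
            (\<Sum>k\<le>N. fps_nth Q k * (real (Suc (m * k)) * s ^ (m * k)))) (at s)"
          by (auto intro!: derivative_eq_intros DERIV_sum simp del: power_Suc of_nat_Suc)
        also have "(\<Sum>k\<le>N. fps_nth Q k * (real (Suc (m * k)) * s ^ (m * k))) =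
            (\<Sum>k\<le>N. (1 + real m * real k) * fps_nth Q k * (s ^ m) ^ k)"
          unfolding power_mult of_nat_Suc of_nat_mult by (simp only: mult_ac add_ac)
        finally show ?thesis unfolding eq Q_nth by (simp add: sum_distrib_left mult_ac)
      qed
      have powr': "((\<lambda>t. (t ^ n - 1) powr (1 / real m)) has_real_derivative
          real n / real m * u ^ (n - 1) * d) (at u)"
      proof -
        have "((\<lambda>t. (t ^ n - 1) powr (1 / real m)) has_real_derivative
            1 / real m * (u ^ n - 1) powr (1 / real m - 1) * (real n * u ^ (n - 1))) (at u)"
          using un by (auto intro!: derivative_eq_intros)
        also have "1 / real m - 1 = - expo" using m by (simp add: field_simps)
        finally show ?thesis by (simp add: d_def powr_minus_divide mult_ac)
      qed
      have "(\<Sum>k\<le>N. fps_nth (P ^ (n - 1)) k * (s ^ m) ^ k) \<le> Y s ^ (n - 1)"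
        unfolding Y_def using s P_nonneg by (intro sum_fps_power_le) auto
      also have "\<dots> \<le> u ^ (n - 1)"
        using Suc.IH[of u] u Y_nonneg[OF s] by (intro power_mono) (auto simp: Y_def s_def)
      finally have le: "real n / real m * (\<Sum>k\<le>N. fps_nth (P ^ (n - 1)) k * (s ^ m) ^ k) * d
          \<le> real n / real m * u ^ (n - 1) * d"
        using d by (intro mult_right_mono mult_left_mono) auto
      have "(h has_real_derivative real n / real m * u ^ (n - 1) * d
          - real n / real m * (\<Sum>k\<le>N. fps_nth (P ^ (n - 1)) k * (s ^ m) ^ k) * d) (at u)"
        unfolding h_def[abs_def]
        by (rule DERIV_diff[OF powr' DERIV_chain2[OF dV[unfolded s_def] \<Phi>', folded s_def]])
      then show "\<exists>D. (h has_real_derivative D) (at u) \<and> 0 \<le> D"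
        using le by (intro exI conjI) auto
    qed
    then show ?thesis using Phi_1 by (simp add: h_def)
  qed
  define h where "h t = t - Y' (Phi expo n t)" for t
  have "h 1 \<le> h y"
  proof (rule DERIV_nonneg_imp_increasing_open[OF Suc.prems])
    show "continuous_on {1..y} h"
      unfolding h_def[abs_def] Y'_def
      by (intro continuous_intros Phi_continuous_on[OF expo n_pos])
    fix u assume u: "1 < u" "u < y"
    define s where "s = Phi expo n u"
    have s: "0 \<le> s" using \<Phi>_nonneg[of u] u by (simp add: s_def)
    have un: "0 < u ^ n - 1" using one_less_power[OF u(1) n_pos] by simp
    define d where "d = 1 / (u ^ n - 1) powr expo"
    have d: "0 \<le> d" by (simp add: d_def)
    have \<Phi>': "(Phi expo n has_real_derivative d) (at u)"
      unfolding d_def by (rule Phi_has_derivative[OF expo n_pos u(1)])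
    have dY: "(Y' has_real_derivative
        s ^ (m - 1) * (\<Sum>k\<le>N. fps_nth (Q ^ (m - 1)) k * (s ^ m) ^ k)) (at s)"
    proof -
      have eq: "Y' = (\<lambda>s. fps_nth P 0 + (\<Sum>k\<le>N. fps_nth P (Suc k) * s ^ Suc (m - 1 + m * k)))"
        unfolding Y'_def sum.atMost_Suc_shift using m
        by (auto simp: fun_eq_iff simp flip: power_mult power_Suc)
      have "(Y' has_real_derivative
          (\<Sum>k\<le>N. fps_nth P (Suc k) * (real (Suc (m - 1 + m * k)) * s ^ (m - 1 + m * k)))) (at s)"
        unfolding eq
        by (auto intro!: derivative_eq_intros DERIV_sum sum.cong simp: mult_ac simp del: power_Suc of_nat_Suc)
      also have "(\<Sum>k\<le>N. fps_nth P (Suc k) * (real (Suc (m - 1 + m * k)) * s ^ (m - 1 + m * k))) =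
          s ^ (m - 1) * (\<Sum>k\<le>N. real m * real (Suc k) * fps_nth P (Suc k) * (s ^ m) ^ k)"
        unfolding sum_distrib_left
      proof (intro sum.cong refl)
        fix k
        have e: "Suc (m - 1 + m * k) = m * Suc k" using m by simp
        show "fps_nth P (Suc k) * (real (Suc (m - 1 + m * k)) * s ^ (m - 1 + m * k)) =
            s ^ (m - 1) * (real m * real (Suc k) * fps_nth P (Suc k) * (s ^ m) ^ k)"
          unfolding e power_add power_mult of_nat_mult by (simp only: mult_ac)
      qed
      finally show ?thesis unfolding P_Suc .
    qed
    have "s ^ (m - 1) * (\<Sum>k\<le>N. fps_nth (Q ^ (m - 1)) k * (s ^ m) ^ k) \<le> s ^ (m - 1) * q s ^ (m - 1)"
      unfolding q_def using s Q_nonneg by (intro mult_left_mono sum_fps_power_le) auto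
    also have "\<dots> = (s * q s) ^ (m - 1)" by (simp add: power_mult_distrib)
    also have "\<dots> \<le> ((u ^ n - 1) powr (1 / real m)) ^ (m - 1)"
      using V_le[of u] u s q_nonneg[OF s] by (intro power_mono) (auto simp: s_def)
    also have "\<dots> = (u ^ n - 1) powr expo"
      using un m by (simp add: powr_powr of_nat_diff flip: powr_realpow)
    finally have "s ^ (m - 1) * (\<Sum>k\<le>N. fps_nth (Q ^ (m - 1)) k * (s ^ m) ^ k) * d
        \<le> (u ^ n - 1) powr expo * d" using d by (rule mult_right_mono)
    also have "\<dots> = 1" using un by (simp add: d_def)
    finally have le: "s ^ (m - 1) * (\<Sum>k\<le>N. fps_nth (Q ^ (m - 1)) k * (s ^ m) ^ k) * d \<le> 1" .
    have "(h has_real_derivative 1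
        - s ^ (m - 1) * (\<Sum>k\<le>N. fps_nth (Q ^ (m - 1)) k * (s ^ m) ^ k) * d) (at u)"
      unfolding h_def[abs_def]
      by (rule DERIV_diff[OF DERIV_ident DERIV_chain2[OF dY[unfolded s_def] \<Phi>', folded s_def]])
    then show "\<exists>D. (h has_real_derivative D) (at u) \<and> 0 \<le> D"
      using le by (intro exI conjI) auto
  qed
  moreover have "Y' 0 = 1"
    unfolding Y'_def sum.atMost_Suc_shift using m by (simp add: P_0 power_0_left)
  ultimately show ?case by (simp add: h_def Y'_def)
qed

text \<open>Nonnegative terms with bounded partial sums: the series converges at every time at which the
  trajectory is still finite.\<close>
lemma conv_radius_P_ge:
  assumes "1 \<le> y"
  shows "ereal (Phi expo n y ^ m) \<le> fps_conv_radius P"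
proof -
  have pos: "0 \<le> Phi expo n y" using Phi_nonneg[OF expo n_pos assms] .
  have "summable (\<lambda>k. fps_nth P k * (Phi expo n y ^ m) ^ k)"
  proof (rule summableI_nonneg_bounded)
    show "0 \<le> fps_nth P k * (Phi expo n y ^ m) ^ k" for k using P_nonneg pos by simp
    show "(\<Sum>k<N. fps_nth P k * (Phi expo n y ^ m) ^ k) \<le> y" for N
    proof -
      have "(\<Sum>k<N. fps_nth P k * (Phi expo n y ^ m) ^ k) \<le> (\<Sum>k\<le>N. fps_nth P k * (Phi expo n y ^ m) ^ k)"
        using P_nonneg pos by (intro sum_mono2) auto
      then show ?thesis using partial_sums_le[OF assms, of N] by linarith
    qed
  qed
  then show ?thesis
    unfolding fps_conv_radius_def using pos conv_radius_geI by fastforce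
qed

lemma conv_radius_P_pos: "0 < fps_conv_radius P"
proof -
  have "0 < Phi expo n 2" using Phi_strict_mono[OF expo n_pos, of 1 2] Phi_1 by simp
  then have "0 < ereal (Phi expo n 2 ^ m)" by simp
  also have "\<dots> \<le> fps_conv_radius P" by (rule conv_radius_P_ge) simp
  finally show ?thesis .
qed

text \<open>Conversely, wherever the series converges its sum is the trajectory, which therefore has not
  blown up before that time: along the sum \<open>A\<close>, the derivative of \<open>Phi expo n (A s)\<close> is
  \<open>A' / (A ^ n - 1) powr expo = 1\<close>.\<close>
lemma Phi_eval:
  assumes "0 < s" "ereal (s ^ m) < fps_conv_radius P"
  shows "1 \<le> eval_fps P (s ^ m)" and "Phi expo n (eval_fps P (s ^ m)) = s"
proof -
  define A where "A t = eval_fps P (t ^ m)" for t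
  define B where "B t = t * eval_fps Q (t ^ m)" for t
  have conv: "ereal (t ^ m) < fps_conv_radius P" if "0 \<le> t" "t \<le> s" for t
    using power_mono[OF that(2,1), of m] assms(2) by (meson ereal_less_eq(3) le_less_trans)
  have A_ge: "1 \<le> A t" if "0 \<le> t" "t \<le> s" for t
    using eval_fps_ge_nth_0[OF P_nonneg, of "t ^ m"] conv[OF that] that P_0 by (simp add: A_def)
  have B_pos: "0 < B t" if "0 < t" "t \<le> s" for t
  proof -
    have "ereal (t ^ m) < fps_conv_radius Q"
      using conv[of t] that fps_conv_radius_Q by (auto intro: less_le_trans)
    then have "real n / real m \<le> eval_fps Q (t ^ m)"
      using eval_fps_ge_nth_0[OF Q_nonneg, of "t ^ m"] that Q_0 by simp
    moreover have "0 < real n / real m" using m n by simp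
    ultimately show ?thesis using that by (simp add: B_def)
  qed
  have A_deriv: "(A has_real_derivative B t ^ (m - 1)) (at t)" if "0 \<le> t" "t \<le> s" for t
    using derivative_system(1)[of 1 t] conv[OF that] that by (simp add: A_def[abs_def] B_def)
  have AB: "A t ^ n - 1 = B t ^ m" if "0 \<le> t" "t \<le> s" for t
    using first_integral[of 1 t] conv[OF that] that by (simp add: A_def B_def)
  show "1 \<le> eval_fps P (s ^ m)" using A_ge[of s] assms by (simp add: A_def)
  have A_cont: "continuous_on {0..s} A"
    using A_deriv by (intro continuous_at_imp_continuous_on ballI) (auto intro: DERIV_isCont)
  have "Phi expo n (A s) - s = Phi expo n (A 0) - 0"
  proof (rule DERIV_isconst_end[of 0 s "\<lambda>t. Phi expo n (A t) - t"])
    obtain M where "\<And>t. t \<in> {0..s} \<Longrightarrow> A t \<le> M"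
      using continuous_attains_sup[OF compact_Icc _ A_cont] assms by fastforce
    then have "A ` {0..s} \<subseteq> {1..M}" using A_ge by auto
    then show "continuous_on {0..s} (\<lambda>t. Phi expo n (A t) - t)"
      by (intro continuous_intros continuous_on_compose2[OF Phi_continuous_on[OF expo n_pos] A_cont])
    fix t assume t: "0 < t" "t < s"
    then have B: "0 < B t" "0 \<le> t" "t \<le> s" using B_pos by auto
    then have "A t ^ n \<noteq> 1" using AB[of t] by auto
    then have "1 < A t" using A_ge[of t] t by (cases "A t = 1") auto
    then have "(Phi expo n has_real_derivative 1 / (A t ^ n - 1) powr expo) (at (A t))"
      by (rule Phi_has_derivative[OF expo n_pos])
    then have "(Phi expo n has_real_derivative 1 / B t ^ (m - 1)) (at (A t))"
      unfolding AB[OF B(2,3)] power_powr_expo[OF B(1)] .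
    from DERIV_diff[OF DERIV_chain2[OF this A_deriv[OF B(2,3)]] DERIV_ident]
    show "((\<lambda>t. Phi expo n (A t) - t) has_real_derivative 0) (at t)" using B by simp
  qed fact
  also have "A 0 = 1" using m P_0 by (simp add: A_def eval_fps_at_0 power_0_left)
  finally show "Phi expo n (eval_fps P (s ^ m)) = s" using Phi_1 by (simp add: A_def)
qed

text \<open>For \<open>e = - 1\<close> the first component decreases from \<open>1\<close>, and the derivative of
  \<open>F_pn p n (A z)\<close> is \<open>A' / (1 - A ^ n) powr (1 / p) = - 1\<close>. Hence \<open>A z\<close> is the generalized sine of
  \<open>pi_pn p n / 2 - z\<close>.\<close>
lemma F_pn_eval_near_0:
  assumes p: "p > 1" "1 / p = expo"
  obtains \<delta> where "\<delta> > 0" "ereal (\<delta> ^ m) < fps_conv_radius P"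
    "\<And>z. 0 \<le> z \<Longrightarrow> z \<le> \<delta> \<Longrightarrow> eval_fps P (- (z ^ m)) \<in> {0..1} \<and>
        F_pn p n (eval_fps P (- (z ^ m))) = pi_pn p n / 2 - z"
proof -
  define A where "A t = eval_fps P (- (t ^ m))" for t
  define B where "B t = t * eval_fps Q (- (t ^ m))" for t
  have A_0: "A 0 = 1" and B_0: "B 0 = 0"
    using m P_0 by (simp_all add: A_def B_def eval_fps_at_0 power_0_left)
  obtain r where r: "0 < r" "ereal r < fps_conv_radius P"
    using ereal_dense2[OF conv_radius_P_pos] by auto
  have A_deriv: "(A has_real_derivative - (B t ^ (m - 1))) (at t)"
    and B_deriv: "(B has_real_derivative real n / real m * A t ^ (n - 1)) (at t)"
    and AB: "A t ^ n = 1 - B t ^ m" if "ereal (t ^ m) < fps_conv_radius P" "0 \<le> t" for t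
    using derivative_system[of "-1" t] first_integral[of "-1" t] that
    by (simp_all add: A_def[abs_def] B_def[abs_def])
  have "isCont A 0"
    using A_deriv[of 0, THEN DERIV_isCont] conv_radius_P_pos m by (simp add: power_0_left flip: zero_ereal_def)
  then have "(A \<longlongrightarrow> 1) (at 0)" unfolding isCont_def A_0 .
  then have "eventually (\<lambda>t. 0 < A t) (at 0)" by (rule order_tendstoD) simp
  then obtain d where d: "0 < d" "\<And>t. t \<noteq> 0 \<Longrightarrow> \<bar>t\<bar> < d \<Longrightarrow> 0 < A t"
    unfolding eventually_at by (auto simp: dist_real_def)
  \<comment> \<open>The bound \<open>\<delta> \<le> 1\<close> gives \<open>t ^ m \<le> t \<le> r\<close>.\<close>
  define \<delta> where "\<delta> = min (d / 2) (min 1 r)"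
  have \<delta>: "0 < \<delta>" "\<delta> < d" "\<delta> \<le> 1" "\<delta> \<le> r" using d(1) r(1) by (auto simp: \<delta>_def)
  have conv: "ereal (t ^ m) < fps_conv_radius P" if "0 \<le> t" "t \<le> \<delta>" for t
  proof -
    have "t ^ m \<le> t ^ 1" using that \<delta> m by (intro power_decreasing) auto
    then have "t ^ m \<le> r" using that \<delta> by simp
    then show ?thesis using r(2) by (meson ereal_less_eq(3) le_less_trans)
  qed
  have A_pos: "0 < A t" if "0 \<le> t" "t \<le> \<delta>" for t
    using d(2)[of t] that \<delta> A_0 by (cases "t = 0") auto
  have B_pos: "0 < B t" if "0 < t" "t \<le> \<delta>" for t
  proof -
    have "B 0 < B t"
    proof (rule DERIV_pos_imp_increasing_open[OF that(1)])
      fix u assume "0 < u" "u < t"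
      then have u: "0 \<le> u" "u \<le> \<delta>" using that by auto
      have "0 < real n / real m * A u ^ (n - 1)" using A_pos[OF u] m n by simp
      then show "\<exists>y. (B has_real_derivative y) (at u) \<and> 0 < y"
        using B_deriv[OF conv[OF u] u(1)] by blast
    next
      show "continuous_on {0..t} B"
        using that by (intro continuous_at_imp_continuous_on ballI DERIV_isCont[OF B_deriv] conv) auto
    qed
    then show ?thesis by (simp add: B_0)
  qed
  have A_less: "A t < 1" if "0 < t" "t \<le> \<delta>" for t
  proof -
    have "A t ^ n < 1" using AB[OF conv, of t] B_pos[OF that] that by simp
    then show ?thesis using one_le_power[of "A t" n] by linarith
  qed
  have F: "F_pn p n (A z) = pi_pn p n / 2 - z" if z: "0 \<le> z" "z \<le> \<delta>" for z
  proof (cases "z = 0")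
    case True
    then show ?thesis by (simp add: A_0 pi_pn_def)
  next
    case False
    have A_cont: "continuous_on {0..z} A"
      using z by (intro continuous_at_imp_continuous_on ballI DERIV_isCont[OF A_deriv] conv) auto
    have "F_pn p n (A z) + z = F_pn p n (A 0) + 0"
    proof (rule DERIV_isconst_end[of 0 z "\<lambda>t. F_pn p n (A t) + t"])
      have "A ` {0..z} \<subseteq> {0..1}"
      proof
        fix y assume "y \<in> A ` {0..z}"
        then obtain t where t: "0 \<le> t" "t \<le> \<delta>" "y = A t" using z by auto
        then show "y \<in> {0..1}" using A_pos[of t] A_less[of t] A_0 by (cases "t = 0") auto
      qed
      moreover have "continuous_on {0..1} (F_pn p n)"
        by (rule F_pn_continuous_on) (use p n in \<open>auto simp: dom_F_def\<close>)
      ultimately show "continuous_on {0..z} (\<lambda>t. F_pn p n (A t) + t)"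
        by (intro continuous_intros continuous_on_compose2[OF _ A_cont])
      fix t assume t: "0 < t" "t < z"
      then have t': "0 \<le> t" "t \<le> \<delta>" using z by auto
      have B: "0 < B t" using B_pos[of t] t z by simp
      have "(F_pn p n has_real_derivative 1 / (1 - A t ^ n) powr (1 / p)) (at (A t))"
        by (rule F_pn_has_derivative) (use p n A_less[of t] A_pos[of t] t t' in auto)
      also have "(1 - A t ^ n) powr (1 / p) = B t ^ (m - 1)"
        using AB[OF conv[OF t'] t'(1)] power_powr_expo[OF B] p(2) by simp
      finally have "(F_pn p n has_real_derivative 1 / B t ^ (m - 1)) (at (A t))" .
      from DERIV_add[OF DERIV_chain2[OF this A_deriv[OF conv[OF t'] t'(1)]] DERIV_ident]
      show "((\<lambda>t. F_pn p n (A t) + t) has_real_derivative 0) (at t)" using B by simp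
    qed (use False z in auto)
    then show ?thesis by (simp add: A_0 pi_pn_def)
  qed
  show thesis
  proof (rule that[of \<delta>])
    show "ereal (\<delta> ^ m) < fps_conv_radius P" using conv[of \<delta>] \<delta> by simp
    fix z assume z: "0 \<le> z" "z \<le> \<delta>"
    then have "A z \<in> {0..1}" using A_pos[of z] A_less[of z] A_0 by (cases "z = 0") auto
    then show "eval_fps P (- (z ^ m)) \<in> {0..1} \<and> F_pn p n (eval_fps P (- (z ^ m))) = pi_pn p n / 2 - z"
      using F[OF z] by (simp add: A_def)
  qed fact
qed

end

section \<open>Real power series\<close>

text \<open>A real power series can be expanded about any point inside its disc of convergence, since
  this holds for the complex series with the same coefficients; the real parts of the complex
  coefficients serve.\<close>
lemma eval_fps_shifted_has_fps_expansion:
  fixes T :: "real fps"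
  assumes "ereal \<bar>x\<bar> < fps_conv_radius T"
  shows "\<exists>A. (\<lambda>h. eval_fps T (x + h)) has_fps_expansion A"
proof -
  define C where "C = Abs_fps (\<lambda>k. complex_of_real (fps_nth T k))"
  have rad: "fps_conv_radius C = fps_conv_radius T"
    using fps_conv_radius_norm[of C] fps_conv_radius_norm[of T] by (simp add: C_def)
  have ev: "eval_fps C (of_real t) = of_real (eval_fps T t)" if "ereal \<bar>t\<bar> < fps_conv_radius T" for t
  proof -
    have "(\<lambda>k. fps_nth T k * t ^ k) sums eval_fps T t"
      using that by (intro sums_eval_fps) auto
    then have "(\<lambda>k. of_real (fps_nth T k * t ^ k) :: complex) sums of_real (eval_fps T t)"
      by (rule sums_of_real)
    then show ?thesis by (simp add: C_def eval_fps_def sums_iff)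
  qed
  have "eval_fps C analytic_on {of_real x}"
    using assms by (intro analytic_on_eval_fps) (auto simp: in_eball_iff rad)
  then have "(\<lambda>h. eval_fps C (of_real x + h)) has_fps_expansion fps_expansion (eval_fps C) (of_real x)"
    by (rule analytic_at_imp_has_fps_expansion)
  then obtain B where B: "(\<lambda>h. eval_fps C (of_real x + h)) has_fps_expansion B" by blast
  define A where "A = Abs_fps (\<lambda>k. Re (fps_nth B k))"
  have "eventually (\<lambda>z. z \<in> eball 0 (fps_conv_radius B)) (nhds 0)"
    using B by (intro eventually_nhds_in_open) (auto simp: has_fps_expansion_def zero_ereal_def)
  moreover have "eventually (\<lambda>z. eval_fps B z = eval_fps C (of_real x + z)) (nhds 0)"
    using B by (simp add: has_fps_expansion_def)
  ultimately have "eventually (\<lambda>z. (\<lambda>k. fps_nth B k * z ^ k) sums eval_fps C (of_real x + z)) (nhds 0)"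
    by eventually_elim (metis dist_0_norm in_eball_iff sums_eval_fps)
  moreover have "filterlim complex_of_real (nhds 0) (nhds 0)"
    using tendsto_of_real[OF filterlim_ident[of "nhds (0::real)"], where 'a = complex] by simp
  ultimately have ev1: "eventually (\<lambda>h. (\<lambda>k. fps_nth B k * of_real h ^ k) sums
      eval_fps C (of_real x + of_real h)) (nhds (0::real))"
    by (rule eventually_compose_filterlim)
  have "open {t. ereal \<bar>t\<bar> < fps_conv_radius T}"
    using open_eball[of "0::real" "fps_conv_radius T"] by (simp add: eball_def)
  then have "eventually (\<lambda>t. t \<in> {t. ereal \<bar>t\<bar> < fps_conv_radius T}) (nhds x)"
    using assms by (intro eventually_nhds_in_open) auto
  moreover have "filterlim (\<lambda>h. x + h) (nhds x) (nhds 0)"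
    using tendsto_add[OF tendsto_const[of x] filterlim_ident[of "nhds (0::real)"]] by simp
  ultimately have ev2: "eventually (\<lambda>h. x + h \<in> {t. ereal \<bar>t\<bar> < fps_conv_radius T}) (nhds 0)"
    by (rule eventually_compose_filterlim)
  have "eventually (\<lambda>h. (\<lambda>k. fps_nth A k * h ^ k) sums eval_fps T (x + h)) (nhds 0)"
    using ev1 ev2
  proof eventually_elim
    case (elim h)
    then have "(\<lambda>k. fps_nth B k * of_real h ^ k) sums of_real (eval_fps T (x + h))"
      using ev[of "x + h"] by simp
    then have "(\<lambda>k. Re (fps_nth B k * of_real h ^ k)) sums Re (of_real (eval_fps T (x + h)))"
      by (rule sums_Re)
    then show ?case by (simp add: A_def flip: of_real_power)
  qed
  then show ?thesis by (blast intro: has_fps_expansionI)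
qed

lemma eval_fps_shift_tendsto:
  fixes A :: "real fps"
  assumes "0 < fps_conv_radius A" "k \<le> subdegree A"
  shows "((\<lambda>h. eval_fps A h / h ^ k) \<longlongrightarrow> fps_nth A k) (at 0)"
proof -
  have "eventually (\<lambda>z. z \<in> eball 0 (fps_conv_radius A)) (at 0)"
    using assms(1) by (intro eventually_at_in_open'[THEN eventually_mono]) (auto simp: zero_ereal_def)
  moreover have "eventually (\<lambda>z::real. z \<noteq> 0) (at 0)" by (simp add: eventually_at_filter)
  ultimately have ev: "eventually (\<lambda>h. eval_fps (fps_shift k A) h = eval_fps A h / h ^ k) (at 0)"
  proof eventually_elim
    case (elim h)
    then show ?case using assms by (subst eval_fps_shift) auto
  qed
  have "isCont (eval_fps (fps_shift k A)) 0"
    using assms by (intro continuous_eval_fps) (auto simp flip: zero_ereal_def)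
  then have "(eval_fps (fps_shift k A) \<longlongrightarrow> fps_nth A k) (at 0)"
    by (simp add: isCont_def eval_fps_at_0)
  then show ?thesis using ev by (rule Lim_transform_eventually)
qed

text \<open>An identity theorem for which agreement on one side of the origin is enough: a nonzero
  difference, divided by the leading power of the variable, would have a nonzero limit.\<close>
lemma fps_eqI_eval_at_left:
  fixes A B :: "real fps"
  assumes "0 < fps_conv_radius A" "0 < fps_conv_radius B"
    and "eventually (\<lambda>h. eval_fps A h = eval_fps B h) (at_left 0)"
  shows "A = B"
proof (rule ccontr)
  assume "A \<noteq> B"
  define D where "D = A - B"
  define k where "k = subdegree D"
  have D: "D \<noteq> 0" using \<open>A \<noteq> B\<close> by (simp add: D_def)
  have rad: "0 < fps_conv_radius D"
    using fps_conv_radius_diff[of A B] assms(1,2) unfolding D_def by (meson less_le_trans min_less_iff_conj)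
  have "((\<lambda>h. eval_fps D h / h ^ k) \<longlongrightarrow> fps_nth D k) (at_left 0)"
    using eval_fps_shift_tendsto[OF rad, of k] unfolding k_def
    by (meson at_le order_refl subset_UNIV tendsto_mono)
  moreover have "eventually (\<lambda>h. h \<in> eball 0 (min (fps_conv_radius A) (fps_conv_radius B))) (at_left (0::real))"
    using assms(1,2)
    by (intro eventually_at_in_open'[THEN filter_leD[OF at_le, rotated]]) (auto simp: zero_ereal_def)
  then have "eventually (\<lambda>h. 0 = eval_fps D h / h ^ k) (at_left 0)"
    using assms(3)
  proof eventually_elim
    case (elim h)
    then show ?case unfolding D_def by (subst eval_fps_diff) auto
  qed
  then have "((\<lambda>h. eval_fps D h / h ^ k) \<longlongrightarrow> 0) (at_left 0)"
    by (rule Lim_transform_eventually[OF tendsto_const])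
  ultimately have "fps_nth D k = 0"
    by (intro tendsto_unique) (auto simp: trivial_limit_at_left_real)
  then show False using D by (simp add: k_def)
qed

lemma higher_deriv_eq_fps_nth:
  fixes g :: "real \<Rightarrow> real"
  assumes "(\<lambda>h. g (x + h)) has_fps_expansion A"
  shows "(deriv ^^ k) g x = fact k * fps_nth A k"
  using assms
proof (induction k arbitrary: g A)
  case 0
  then have "eventually (\<lambda>h. eval_fps A h = g (x + h)) (nhds 0)" by (simp add: has_fps_expansion_def)
  then have "eval_fps A 0 = g (x + 0)" by (rule eventually_nhds_x_imp_x)
  then show ?case by (simp add: eval_fps_at_0)
next
  case (Suc k)
  have "deriv (\<lambda>h. g (x + h)) = (\<lambda>h. deriv g (x + h))"
  proof
    fix h show "deriv (\<lambda>h. g (x + h)) h = deriv g (x + h)"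
      unfolding deriv_def by (simp add: DERIV_shift[of g _ h x, symmetric] add.commute)
  qed
  then have "(\<lambda>h. deriv g (x + h)) has_fps_expansion fps_deriv A"
    using has_fps_expansion_deriv[OF Suc.prems] by simp
  then have "(deriv ^^ k) (deriv g) x = fact k * fps_nth (fps_deriv A) k" by (rule Suc.IH)
  then show ?case by (simp add: funpow_Suc_right del: funpow.simps)
qed

lemma taylor_fps_eq:
  assumes "(\<lambda>h. g (x + h)) has_fps_expansion A"
  shows "taylor_fps g x = A"
  by (rule fps_ext) (simp add: taylor_fps_def higher_deriv_eq_fps_nth[OF assms])

lemma critical_point_of_order_iff_fps:
  assumes "(\<lambda>h. g (x + h)) has_fps_expansion A"
  shows "critical_point_of_order g x k \<longleftrightarrow> (\<forall>j<k. fps_nth A (Suc j) = 0) \<and> fps_nth A (Suc k) \<noteq> 0"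
proof -
  have "(deriv ^^ j) (deriv g) x = fact (Suc j) * fps_nth A (Suc j)" for j
    using higher_deriv_eq_fps_nth[OF assms, of "Suc j"] by (simp add: funpow_Suc_right del: funpow.simps)
  then show ?thesis by (simp add: critical_point_of_order_def zero_of_order_def del: fact_Suc)
qed

text \<open>The series \<open>P (c * X ^ m)\<close>.\<close>
definition fps_subst_power :: "nat \<Rightarrow> real \<Rightarrow> real fps \<Rightarrow> real fps" where
  "fps_subst_power m c P = Abs_fps (\<lambda>j. if m dvd j then c ^ (j div m) * fps_nth P (j div m) else 0)"

lemma fps_subst_power_sums_iff:
  assumes "m > 0"
  shows "(\<lambda>j. fps_nth (fps_subst_power m c P) j * h ^ j) sums S \<longleftrightarrow>
    (\<lambda>k. fps_nth P k * (c * h ^ m) ^ k) sums S"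
proof -
  have "(\<lambda>j. fps_nth (fps_subst_power m c P) j * h ^ j) sums S \<longleftrightarrow>
      (\<lambda>k. fps_nth (fps_subst_power m c P) (m * k) * h ^ (m * k)) sums S"
    by (rule sums_mono_reindex[symmetric])
       (use assms in \<open>auto simp: strict_mono_def fps_subst_power_def\<close>)
  also have "(\<lambda>k. fps_nth (fps_subst_power m c P) (m * k) * h ^ (m * k)) =
      (\<lambda>k. fps_nth P k * (c * h ^ m) ^ k)"
    using assms by (auto simp: fps_subst_power_def power_mult_distrib power_mult)
  finally show ?thesis .
qed

lemma eval_fps_subst_power:
  assumes "m > 0" "ereal \<bar>c * h ^ m\<bar> < fps_conv_radius P"
  shows "eval_fps (fps_subst_power m c P) h = eval_fps P (c * h ^ m)"
proof -
  have "(\<lambda>k. fps_nth P k * (c * h ^ m) ^ k) sums eval_fps P (c * h ^ m)"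
    using assms(2) by (intro sums_eval_fps) auto
  then have "(\<lambda>j. fps_nth (fps_subst_power m c P) j * h ^ j) sums eval_fps P (c * h ^ m)"
    by (simp add: fps_subst_power_sums_iff assms(1))
  then show ?thesis unfolding eval_fps_def by (rule sums_unique[symmetric])
qed

text \<open>The two assumptions about \<open>P\<close> say that its radius of convergence is \<open>\<mu> ^ m\<close>. They are
  phrased in terms of points \<open>r\<close> so that no \<open>m\<close>-th root of a radius, possibly infinite, is needed.\<close>
lemma fps_conv_radius_subst_power:
  fixes \<mu> c :: real
  assumes m: "m > 0" and c: "\<bar>c\<bar> = 1"
    and ge: "\<And>r. 0 < r \<Longrightarrow> r < \<mu> \<Longrightarrow> ereal (r ^ m) < fps_conv_radius P"
    and le: "\<And>r. 0 < r \<Longrightarrow> ereal (r ^ m) < fps_conv_radius P \<Longrightarrow> r \<le> \<mu>"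
    and \<mu>: "0 < \<mu>"
  shows "fps_conv_radius (fps_subst_power m c P) = ereal \<mu>"
proof (rule antisym)
  have abs: "\<bar>c * r ^ m\<bar> = r ^ m" if "0 < r" for r
    using that c by (simp add: abs_mult)
  show "ereal \<mu> \<le> fps_conv_radius (fps_subst_power m c P)"
    unfolding fps_conv_radius_def[of "fps_subst_power m c P"]
  proof (rule conv_radius_geI_ex')
    fix r assume r: "0 < r" "ereal r < ereal \<mu>"
    then have "(\<lambda>k. fps_nth P k * (c * r ^ m) ^ k) sums eval_fps P (c * r ^ m)"
      using ge[of r] abs[of r] by (intro sums_eval_fps) auto
    then have "(\<lambda>j. fps_nth (fps_subst_power m c P) j * r ^ j) sums eval_fps P (c * r ^ m)"
      by (simp add: fps_subst_power_sums_iff m)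
    then show "summable (\<lambda>j. fps_nth (fps_subst_power m c P) j * of_real r ^ j)"
      by (auto simp: sums_iff)
  qed
  show "fps_conv_radius (fps_subst_power m c P) \<le> ereal \<mu>"
    unfolding fps_conv_radius_def[of "fps_subst_power m c P"]
  proof (rule conv_radius_leI_ex')
    show "0 \<le> ereal \<mu>" using \<mu> by simp
    fix r assume r: "0 < r" "ereal \<mu> < ereal r"
    show "\<not> summable (\<lambda>j. fps_nth (fps_subst_power m c P) j * of_real r ^ j)"
    proof
      assume "summable (\<lambda>j. fps_nth (fps_subst_power m c P) j * of_real r ^ j)"
      then have "summable (\<lambda>k. fps_nth P k * (c * r ^ m) ^ k)"
        using fps_subst_power_sums_iff[OF m] by (auto simp: summable_def)
      then have "ereal (norm (c * r ^ m)) \<le> fps_conv_radius P"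
        unfolding fps_conv_radius_def by (rule conv_radius_geI)
      then have "ereal (r ^ m) \<le> fps_conv_radius P" using abs[OF r(1)] by simp
      moreover obtain q where q: "\<mu> < q" "q < r" using r dense by auto
      then have "ereal (q ^ m) < ereal (r ^ m)" using \<mu> m by (auto intro!: power_strict_mono)
      ultimately have "ereal (q ^ m) < fps_conv_radius P" by (rule less_le_trans[rotated])
      then show False using le[of q] q \<mu> by simp
    qed
  qed
qed

section \<open>The expansion at the quarter period\<close>

text \<open>The radius does not depend on the sign of \<open>c\<close>. So the Taylor series of the sine has the radius
  of the growing solution, whose singularity is at the blow-up time. The exclusion of \<open>m = n = 2\<close> makes
  \<open>n * (m - 1) / m > 1\<close>, which is what the finiteness of the blow-up time requires.\<close>
lemma (in polynomial_system) fps_conv_radius_subst_P: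
  assumes "\<not> (m = 2 \<and> n = 2)" "\<bar>c\<bar> = 1"
  shows "fps_conv_radius (fps_subst_power m c P) = ereal (mu (real m) n)"
proof -
  have "m < n * m - n"
  proof -
    obtain m' n' where "m = Suc (Suc m')" "n = Suc (Suc n')"
      using m n by (metis Suc_le_D numeral_2_eq_2 Suc_le_mono)
    then show ?thesis using assms(1) by auto
  qed
  then have "real m < real (n * m - n)" by linarith
  also have "\<dots> = (real m - 1) * real n" using m by (simp add: of_nat_diff algebra_simps)
  finally have an: "1 < expo * real n" using m by (simp add: field_simps)
  have mu: "mu (real m) n = (LBINT t=1..\<infinity>. 1 / (t ^ n - 1) powr expo)"
    by (simp add: mu_def)
  note lim = improper_integral_eq_limit_of_Phi[OF expo n_pos an, folded mu]
  show ?thesis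
  proof (rule fps_conv_radius_subst_power)
    show "0 < mu (real m) n" using lim(1)[of 1] by simp
    fix r :: real assume r: "0 < r"
    show "ereal (r ^ m) < fps_conv_radius P" if r_less: "r < mu (real m) n"
    proof -
      obtain y where y: "y \<ge> 1" "r < Phi expo n y" using lim(2)[OF r_less] by blast
      then have "r ^ m < Phi expo n y ^ m" using r m by (intro power_strict_mono) auto
      then show ?thesis using conv_radius_P_ge[OF y(1)] by (meson ereal_less(2) less_ereal.simps(1) less_le_trans)
    qed
    show "r \<le> mu (real m) n" if "ereal (r ^ m) < fps_conv_radius P"
      using lim(1)[OF Phi_eval(1)[OF r that]] Phi_eval(2)[OF r that] by simp
  qed (use m assms in auto)
qed

text \<open>In terms of \<open>h = - z\<close> the argument \<open>- (z ^ m)\<close> of the series becomes \<open>c * h ^ m\<close> with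
  \<open>c = - ((- 1) ^ m)\<close>.\<close>
lemma (in polynomial_system) sin_pn_power_series:
  assumes p: "p > 1" "1 / p = expo"
  defines "c \<equiv> - ((-1) ^ m) :: real"
  defines "T \<equiv> fps_subst_power m c P"
  obtains \<delta> where "0 < \<delta>" "ereal \<delta> < fps_conv_radius T"
    "\<And>h. - \<delta> \<le> h \<Longrightarrow> h \<le> 0 \<Longrightarrow> sin_pn p n (pi_pn p n / 2 + h) = eval_fps T h"
proof -
  obtain \<delta> where \<delta>: "\<delta> > 0" "ereal (\<delta> ^ m) < fps_conv_radius P"
    and F: "\<And>z. 0 \<le> z \<Longrightarrow> z \<le> \<delta> \<Longrightarrow> eval_fps P (- (z ^ m)) \<in> {0..1} \<and>
        F_pn p n (eval_fps P (- (z ^ m))) = pi_pn p n / 2 - z"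
    using F_pn_eval_near_0[OF p] by blast
  have m_pos: "m > 0" using m by simp
  have "summable (\<lambda>k. fps_nth P k * (c * \<delta> ^ m) ^ k)"
    using \<delta> by (intro summable_fps) (auto simp: c_def abs_mult)
  then have "summable (\<lambda>j. fps_nth T j * \<delta> ^ j)"
    unfolding T_def summable_def fps_subst_power_sums_iff[OF m_pos] .
  then have "ereal (norm \<delta>) \<le> fps_conv_radius T"
    unfolding fps_conv_radius_def by (rule conv_radius_geI)
  then have "ereal (\<delta> / 2) < fps_conv_radius T"
    using \<delta>(1) by (auto intro: less_le_trans[rotated])
  moreover have "sin_pn p n (pi_pn p n / 2 + h) = eval_fps T h" if h: "- (\<delta> / 2) \<le> h" "h \<le> 0" for h
  proof -
    have z: "0 \<le> -h" "-h \<le> \<delta>" using h \<delta>(1) by auto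
    have "(-h) ^ m \<le> \<delta> ^ m" using z by (intro power_mono)
    then have "ereal ((-h) ^ m) < fps_conv_radius P"
      using \<delta>(2) by (meson ereal_less_eq(3) le_less_trans)
    moreover have ch: "c * h ^ m = - ((-h) ^ m)"
      by (simp add: c_def power_minus[of h])
    moreover have "\<bar>c * h ^ m\<bar> = (-h) ^ m"
      using z by (simp add: c_def abs_mult power_abs)
    ultimately have "eval_fps T h = eval_fps P (- ((-h) ^ m))"
      unfolding T_def ch[symmetric] by (intro eval_fps_subst_power m_pos) simp
    moreover have "sin_pn p n (F_pn p n (eval_fps P (- ((-h) ^ m)))) = eval_fps P (- ((-h) ^ m))"
      using F[OF z] p(1) n by (intro sin_pn_F_pn) (auto simp: dom_F_def)
    ultimately show ?thesis using F[OF z] by simp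
  qed
  ultimately show thesis using that[of "\<delta> / 2"] \<delta>(1) by simp
qed

section \<open>The conjugate exponent is an integer if an extension exists\<close>

lemma powr_tendsto_nonzero_imp_exponent_0:
  fixes e L :: real
  assumes "((\<lambda>h. \<bar>h\<bar> powr e) \<longlongrightarrow> L) (at_left 0)" "L \<noteq> 0"
  shows "e = 0"
proof (rule ccontr)
  assume "e \<noteq> 0"
  have zero: "((\<lambda>h::real. \<bar>h\<bar> powr d) \<longlongrightarrow> 0) (at_left 0)" if "d > 0" for d
  proof -
    have "((\<lambda>h::real. \<bar>h\<bar> powr d) \<longlongrightarrow> \<bar>0\<bar> powr d) (at_left 0)"
      by (rule tendsto_powr') (use that in \<open>auto intro!: tendsto_rabs_zero tendsto_ident_at\<close>)
    then show ?thesis by simp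
  qed
  show False
  proof (cases "e > 0")
    case True
    have "L = 0" by (rule tendsto_unique[OF _ assms(1) zero[OF True]]) simp
    then show False using assms(2) by simp
  next
    case False
    have "((\<lambda>h. \<bar>h\<bar> powr (-e)) \<longlongrightarrow> inverse L) (at_left 0)"
      using tendsto_inverse[OF assms] by (simp add: powr_minus)
    moreover have "0 < -e" using False \<open>e \<noteq> 0\<close> by simp
    ultimately have "inverse L = 0" using zero by (intro tendsto_unique[OF _ _ zero]) auto
    then show False using assms(2) by simp
  qed
qed

text \<open>The integer is the order \<open>k\<close> of the zero of \<open>1 - g\<close> at the quarter period. To the left of
  it, \<open>g' = (1 - g ^ n) powr (1 / p)\<close>. The left side vanishes to the order \<open>k - 1\<close>, and \<open>1 - g ^ n\<close>
  vanishes like \<open>1 - g\<close>, so the right side behaves like \<open>\<bar>h\<bar> powr (k / p)\<close>. Therefore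
  \<open>k - 1 = k / p\<close>, that is, \<open>k = p / (p - 1)\<close>.\<close>
lemma conj_exp_eq_if_analytic_extension:
  assumes p: "p > 1" and n: "n > 1" and g: "analytic_extension p n g"
  obtains k :: nat where "conj_exp p = real k"
proof -
  define c where "c = pi_pn p n / 2"
  have n0: "n > 0" using n by simp
  have c_pos: "0 < c" using pi_pn_pos[OF p n0] by (simp add: c_def)
  obtain A where A: "(\<lambda>h. g (c + h)) has_fps_expansion A"
    using g unfolding analytic_extension_def real_analytic_on_def c_def by fastforce
  then have rad: "0 < fps_conv_radius A" by (simp add: has_fps_expansion_def)
  have sin_facts: "g (c + h) \<in> {0..1}" "F_pn p n (g (c + h)) = c + h" if "-c < h" "h \<le> 0" for h
    using near_quarter_period[OF p n0, of "-h"] that g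
    by (auto simp: analytic_extension_def c_def)
  have "F_pn p n (g c) = F_pn p n 1" using sin_facts(2)[of 0] c_pos by (simp add: c_def pi_pn_def)
  moreover have "g c \<in> dom_F n" "1 \<in> dom_F n"
    using sin_facts(1)[of 0] c_pos unfolding dom_F_def by auto
  ultimately have g_c: "g c = 1"
    by (rule inj_onD[OF strict_mono_on_imp_inj_on[OF F_pn_strict_mono_on[OF p n0]]])
  have g_less: "g (c + h) < 1" if "-c < h" "h < 0" for h
  proof -
    have "g (c + h) \<noteq> 1" using sin_facts(2)[of h] that by (auto simp: c_def pi_pn_def)
    then show ?thesis using sin_facts(1)[of h] that by auto
  qed
  have "eventually (\<lambda>h. h \<in> eball 0 (fps_conv_radius A) \<and> eval_fps A h = g (c + h)) (nhds 0)"
    using A by (intro eventually_conj eventually_nhds_in_open) (auto simp: has_fps_expansion_def zero_ereal_def)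
  then obtain U where U: "open U" "0 \<in> U" "\<And>h. h \<in> U \<Longrightarrow> ereal \<bar>h\<bar> < fps_conv_radius A"
      "\<And>h. h \<in> U \<Longrightarrow> eval_fps A h = g (c + h)"
    by (auto simp: eventually_nhds in_eball_iff)
  obtain d where d: "d > 0" "ball 0 d \<subseteq> U" using U(1,2) open_contains_ball by blast
  have "eventually (\<lambda>h. h \<in> {- min c d<..<0}) (at_left (0::real))"
    by (rule eventually_at_left_real) (use c_pos d in auto)
  then have left: "eventually (\<lambda>h. h < 0 \<and> -c < h \<and> h \<in> U) (at_left (0::real))"
    by eventually_elim (use d in \<open>auto simp: dist_real_def subset_iff\<close>)
  have ode: "eval_fps (fps_deriv A) h = (1 - eval_fps A h ^ n) powr (1 / p)"
    if h: "h < 0" "-c < h" "h \<in> U" for h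
  proof -
    have y: "eval_fps A h \<in> {0..<1}"
      using sin_facts(1)[of h] g_less[of h] U(4)[of h] h by auto
    have dA: "(eval_fps A has_real_derivative eval_fps (fps_deriv A) h) (at h)"
      using U(3)[OF h(3)] by (intro has_field_derivative_eval_fps) auto
    have "(F_pn p n has_real_derivative 1 / (1 - eval_fps A h ^ n) powr (1 / p)) (at (eval_fps A h))"
      by (rule F_pn_has_derivative) (use p n y in auto)
    from DERIV_chain2[OF this dA]
    have D: "((\<lambda>h. F_pn p n (eval_fps A h)) has_real_derivative
        1 / (1 - eval_fps A h ^ n) powr (1 / p) * eval_fps (fps_deriv A) h) (at h)" .
    have "((\<lambda>h. c + h) has_real_derivative
        1 / (1 - eval_fps A h ^ n) powr (1 / p) * eval_fps (fps_deriv A) h) (at h)"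
    proof (rule has_field_derivative_transform_within_open[OF D])
      show "open (U \<inter> {-c<..<0})" using U(1) by auto
      fix t assume "t \<in> U \<inter> {-c<..<0}"
      then show "F_pn p n (eval_fps A t) = c + t" using U(4)[of t] sin_facts(2)[of t] by auto
    qed (use h in auto)
    moreover have "((\<lambda>h. c + h) has_real_derivative 1) (at h)" by (auto intro!: derivative_eq_intros)
    ultimately have "1 / (1 - eval_fps A h ^ n) powr (1 / p) * eval_fps (fps_deriv A) h = 1"
      by (rule DERIV_unique)
    then show ?thesis
      by (metis div_0 divide_eq_1_iff mult.commute mult_1 times_divide_eq_right zero_neq_one)
  qed
  define B where "B = 1 - A"
  define k where "k = subdegree B"
  have rB: "0 < fps_conv_radius B"
    using rad fps_conv_radius_diff[of 1 A] by (auto simp: B_def intro: less_le_trans)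
  have evB: "eval_fps B h = 1 - eval_fps A h" if "h \<in> U" for h
    using U(3)[OF that] by (simp add: B_def eval_fps_diff)
  have A_0: "fps_nth A 0 = 1" using U(4)[OF U(2)] g_c by (simp add: eval_fps_at_0)
  have B_nz: "B \<noteq> 0"
  proof
    assume "B = 0"
    moreover obtain h where "h < 0" "-c < h" "h \<in> U"
      using eventually_happens[OF left] by (auto simp: trivial_limit_at_left_real)
    ultimately show False using evB[of h] U(4)[of h] g_less[of h] by simp
  qed
  have k_pos: "k > 0"
  proof (rule ccontr)
    assume "\<not> k > 0"
    then have "fps_nth B 0 \<noteq> 0" using nth_subdegree_nonzero[OF B_nz] by (simp add: k_def)
    then show False using A_0 by (simp add: B_def)
  qed
  define b where "b = fps_nth B k"
  have b: "b \<noteq> 0" using B_nz by (simp add: b_def k_def)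
  have left_le: "at_left (0::real) \<le> at 0" by (simp add: at_le)
  have lim1: "((\<lambda>h. eval_fps B h / h ^ k) \<longlongrightarrow> b) (at_left 0)"
    using tendsto_mono[OF left_le eval_fps_shift_tendsto[OF rB, of k]] by (simp add: b_def k_def)
  have lim2: "((\<lambda>h. eval_fps (fps_deriv B) h / h ^ (k - 1)) \<longlongrightarrow> real k * b) (at_left 0)"
  proof -
    have nth: "fps_nth (fps_deriv B) (k - 1) = real k * b" using k_pos by (simp add: b_def)
    have "k - 1 \<le> subdegree (fps_deriv B)"
    proof (rule subdegree_geI)
      show "fps_deriv B \<noteq> 0"
      proof
        assume "fps_deriv B = 0"
        then have "real k * b = 0" using nth by (metis fps_zero_nth)
        then show False using k_pos b by simp
      qed
      fix i assume "i < k - 1"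
      then show "fps_nth (fps_deriv B) i = 0"
        using nth_less_subdegree_zero[of "i + 1" B] by (simp add: k_def)
    qed
    moreover have "0 < fps_conv_radius (fps_deriv B)" using rB fps_conv_radius_deriv less_le_trans by blast
    ultimately have "((\<lambda>h. eval_fps (fps_deriv B) h / h ^ (k - 1)) \<longlongrightarrow> fps_nth (fps_deriv B) (k - 1)) (at_left 0)"
      by (intro tendsto_mono[OF left_le eval_fps_shift_tendsto])
    then show ?thesis by (simp only: nth)
  qed
  \<comment> \<open>The two sides of the differential equation with their expected powers of \<open>\<bar>h\<bar>\<close> divided out.\<close>
  define X where "X h = \<bar>eval_fps (fps_deriv B) h / h ^ (k - 1)\<bar>" for h
  define Y where "Y h = (\<bar>eval_fps B h / h ^ k\<bar> * (\<Sum>i<n. eval_fps A h ^ i)) powr (1 / p)" for h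
  have X_lim: "(X \<longlongrightarrow> \<bar>real k * b\<bar>) (at_left 0)"
    unfolding X_def by (rule tendsto_rabs[OF lim2])
  have "isCont (eval_fps A) 0"
    using rad by (intro continuous_eval_fps) (simp flip: zero_ereal_def)
  then have "(eval_fps A \<longlongrightarrow> 1) (at_left 0)"
    using A_0 by (intro tendsto_mono[OF left_le]) (simp add: isCont_def eval_fps_at_0)
  then have "((\<lambda>h. \<Sum>i<n. eval_fps A h ^ i) \<longlongrightarrow> (\<Sum>i<n. 1 ^ i)) (at_left 0)"
    by (intro tendsto_intros)
  then have "((\<lambda>h. \<bar>eval_fps B h / h ^ k\<bar> * (\<Sum>i<n. eval_fps A h ^ i)) \<longlongrightarrow> \<bar>b\<bar> * real n) (at_left 0)"
    by (intro tendsto_mult tendsto_rabs[OF lim1]) simp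
  then have Y_lim: "(Y \<longlongrightarrow> (\<bar>b\<bar> * real n) powr (1 / p)) (at_left 0)"
    unfolding Y_def using b n by (intro tendsto_powr tendsto_const) auto
  have Y_lim_nz: "(\<bar>b\<bar> * real n) powr (1 / p) \<noteq> 0" using b n by simp
  define e where "e = real k / p - real (k - 1)"
  have XY: "X h / Y h = \<bar>h\<bar> powr e" if h: "h < 0" "-c < h" "h \<in> U" for h
  proof -
    have y: "0 \<le> eval_fps A h" "eval_fps A h < 1"
      using sin_facts(1)[of h] g_less[of h] U(4)[of h] h by auto
    define S where "S = (\<Sum>i<n. eval_fps A h ^ i)"
    have "S \<ge> (\<Sum>i\<in>{0}. eval_fps A h ^ i)"
      unfolding S_def using y n by (intro sum_mono2) auto
    then have S: "S > 0" by simp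
    have B_pos: "0 < eval_fps B h" using evB[OF h(3)] y by simp
    define w where "w = eval_fps B h / \<bar>h\<bar> ^ k"
    have w: "w > 0" using B_pos h by (simp add: w_def)
    have "\<bar>eval_fps B h / h ^ k\<bar> = w" using B_pos by (simp add: w_def power_abs)
    then have Y: "Y h = (w * S) powr (1 / p)" by (simp add: Y_def S_def)
    have Y_pos: "Y h > 0" unfolding Y using w S by simp
    have "1 - eval_fps A h ^ n = eval_fps B h * S"
      unfolding S_def evB[OF h(3)] by (rule one_diff_power_eq)
    also have "\<dots> = (w * S) * \<bar>h\<bar> powr real k"
      using h by (simp add: w_def powr_realpow)
    finally have "eval_fps (fps_deriv A) h = Y h * \<bar>h\<bar> powr (real k / p)"
      unfolding ode[OF h] Y using w S by (simp add: powr_mult powr_powr)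
    moreover have "fps_deriv B = - fps_deriv A" by (simp add: B_def)
    then have "eval_fps (fps_deriv B) h = - eval_fps (fps_deriv A) h"
      using U(3)[OF h(3)] fps_conv_radius_deriv[of A]
      by (simp add: eval_fps_minus less_le_trans)
    ultimately have "X h = Y h * \<bar>h\<bar> powr (real k / p) / \<bar>h\<bar> powr real (k - 1)"
      using Y_pos h by (simp add: X_def abs_mult power_abs powr_realpow)
    then show ?thesis using Y_pos by (simp add: e_def powr_diff)
  qed
  have "((\<lambda>h. X h / Y h) \<longlongrightarrow> \<bar>real k * b\<bar> / (\<bar>b\<bar> * real n) powr (1 / p)) (at_left 0)"
    by (rule tendsto_divide[OF X_lim Y_lim Y_lim_nz])
  moreover have "eventually (\<lambda>h. X h / Y h = \<bar>h\<bar> powr e) (at_left 0)"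
    using left by eventually_elim (use XY in blast)
  ultimately have "((\<lambda>h. \<bar>h\<bar> powr e) \<longlongrightarrow> \<bar>real k * b\<bar> / (\<bar>b\<bar> * real n) powr (1 / p)) (at_left 0)"
    by (rule Lim_transform_eventually)
  then have "e = 0"
    by (rule powr_tendsto_nonzero_imp_exponent_0) (use k_pos b n in simp)
  then have "conj_exp p = real k"
    using p k_pos by (simp add: e_def conj_exp_def of_nat_diff field_simps)
  then show thesis by (rule that)
qed

section \<open>The criterion, the critical point and the radius\<close>

lemma (in polynomial_system) analytic_extension_exists:
  assumes p: "p > 1" "1 / p = expo"
  shows "\<exists>g. analytic_extension p n g"
proof -
  define T where "T = fps_subst_power m (- ((-1) ^ m)) P"
  obtain \<delta> where \<delta>: "0 < \<delta>" "ereal \<delta> < fps_conv_radius T"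
    and sin_T: "\<And>h. - \<delta> \<le> h \<Longrightarrow> h \<le> 0 \<Longrightarrow> sin_pn p n (pi_pn p n / 2 + h) = eval_fps T h"
    using sin_pn_power_series[OF p] unfolding T_def by blast
  define c where "c = pi_pn p n / 2"
  define g where "g x = (if x \<in> dom_sin p n then sin_pn p n x else eval_fps T (x - c))" for x
  have g_T: "g x = eval_fps T (x - c)" if "\<bar>x - c\<bar> \<le> \<delta>" for x
  proof (cases "x \<in> dom_sin p n")
    case True
    then have "x \<le> c" by (auto simp: dom_sin_def c_def split: if_splits)
    then show ?thesis using sin_T[of "x - c"] that True by (simp add: g_def c_def)
  qed (simp add: g_def)
  have "real_analytic_on g {c - \<delta><..<c + \<delta>}"
    unfolding real_analytic_on_def
  proof
    fix x assume x: "x \<in> {c - \<delta><..<c + \<delta>}"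
    then have "ereal \<bar>x - c\<bar> < ereal \<delta>" by auto
    then have "ereal \<bar>x - c\<bar> < fps_conv_radius T" using \<delta>(2) by (rule less_trans)
    then obtain A where A: "(\<lambda>h. eval_fps T (x - c + h)) has_fps_expansion A"
      using eval_fps_shifted_has_fps_expansion by blast
    have "open {c - \<delta> - x<..<c + \<delta> - x}" by simp
    then have "eventually (\<lambda>h. h \<in> {c - \<delta> - x<..<c + \<delta> - x}) (nhds 0)"
      by (rule eventually_nhds_in_open) (use x in auto)
    then have "eventually (\<lambda>h. eval_fps T (x - c + h) = g (x + h)) (nhds 0)"
      by eventually_elim (subst g_T, auto simp: algebra_simps)
    moreover have "eventually (\<lambda>h. eval_fps A h = eval_fps T (x - c + h)) (nhds 0)"
      using A by (simp add: has_fps_expansion_def)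
    ultimately have "eventually (\<lambda>h. eval_fps A h = g (x + h)) (nhds 0)"
      by eventually_elim simp
    then show "\<exists>A. (\<lambda>h. g (x + h)) has_fps_expansion A"
      using A by (auto simp: has_fps_expansion_def)
  qed
  then have "\<exists>a b. a < c \<and> c < b \<and> real_analytic_on g {a<..<b}"
    using \<delta>(1) by (intro exI[of _ "c - \<delta>"] exI[of _ "c + \<delta>"]) simp
  then show ?thesis
    unfolding analytic_extension_def c_def[symmetric] by (intro exI[of _ g]) (simp add: g_def)
qed

text \<open>Any two extensions agree to the left of the quarter period, so by the identity theorem they
  all have the expansion found above.\<close>
lemma (in polynomial_system) analytic_extension_has_fps_expansion:
  assumes p: "p > 1" "1 / p = expo" and g: "analytic_extension p n g"
  shows "(\<lambda>h. g (pi_pn p n / 2 + h)) has_fps_expansion fps_subst_power m (- ((-1) ^ m)) P"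
proof -
  define T where "T = fps_subst_power m (- ((-1) ^ m)) P"
  define c where "c = pi_pn p n / 2"
  have c_pos: "0 < c" using pi_pn_pos[OF p(1) n_pos] by (simp add: c_def)
  obtain \<delta> where \<delta>: "0 < \<delta>" "ereal \<delta> < fps_conv_radius T"
    and sin_T: "\<And>h. - \<delta> \<le> h \<Longrightarrow> h \<le> 0 \<Longrightarrow> sin_pn p n (c + h) = eval_fps T h"
    using sin_pn_power_series[OF p] unfolding T_def c_def by blast
  obtain A where A: "(\<lambda>h. g (c + h)) has_fps_expansion A"
    using g unfolding analytic_extension_def real_analytic_on_def c_def by fastforce
  have "A = T"
  proof (rule fps_eqI_eval_at_left)
    show "0 < fps_conv_radius A" using A by (simp add: has_fps_expansion_def)
    have "0 < ereal \<delta>" using \<delta>(1) by simp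
    then show "0 < fps_conv_radius T" using \<delta>(2) by (rule less_trans)
    have "eventually (\<lambda>h. eval_fps A h = g (c + h)) (at_left 0)"
      using A at_within_le_nhds unfolding has_fps_expansion_def by (blast intro: filter_leD)
    moreover have "eventually (\<lambda>h. h \<in> {- min \<delta> c<..<0}) (at_left (0::real))"
      by (rule eventually_at_left_real) (use \<delta>(1) c_pos in auto)
    ultimately show "eventually (\<lambda>h. eval_fps A h = eval_fps T h) (at_left 0)"
    proof eventually_elim
      case (elim h)
      then have "g (c + h) = sin_pn p n (c + h)"
        using near_quarter_period(1)[OF p(1) n_pos, of "-h"] g
        by (auto simp: analytic_extension_def c_def)
      moreover have "- \<delta> \<le> h" "h \<le> 0" using elim by auto
      ultimately show ?case using elim sin_T[of h] by simp
    qed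
  qed
  then show ?thesis using A by (simp add: T_def c_def)
qed

theorem theorem1p1:
  fixes p :: real and n :: nat
  assumes "p > 1" and "n > 1" and "\<not> (p = 2 \<and> n = 2)"
  shows "((\<exists>g. analytic_extension p n g) \<longleftrightarrow> conj_exp p \<in> \<int>) \<and>
    (\<forall>(m::nat) g. conj_exp p = real m \<longrightarrow> analytic_extension p n g \<longrightarrow>
       critical_point_of_order g (pi_pn p n / 2) (m - 1) \<and>
       fps_conv_radius (taylor_fps g (pi_pn p n / 2)) = ereal (mu (conj_exp p) n))"
proof -
  have conj_gt_1: "1 < conj_exp p" using assms(1) by (simp add: conj_exp_def field_simps)
  have conj: "m \<ge> 2" "1 / p = (real m - 1) / real m" "\<not> (m = 2 \<and> n = 2)"
    if conj_m: "conj_exp p = real m" for m :: nat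
  proof -
    show "m \<ge> 2" using conj_gt_1 conj_m by simp
    have pm: "p = real m * (p - 1)" using conj_m assms(1) by (simp add: conj_exp_def field_simps)
    then show "1 / p = (real m - 1) / real m" using assms(1) \<open>m \<ge> 2\<close> by (simp add: field_simps)
    show "\<not> (m = 2 \<and> n = 2)" using pm assms(3) by auto
  qed
  have "conj_exp p \<in> \<int>" if "analytic_extension p n g" for g
    using conj_exp_eq_if_analytic_extension[OF assms(1,2) that] by (metis Ints_of_nat)
  moreover have "\<exists>g. analytic_extension p n g" if "conj_exp p \<in> \<int>"
  proof -
    have "conj_exp p \<in> \<nat>" using that conj_gt_1 by (simp add: Nats_altdef2)
    then obtain m :: nat where conj_m: "conj_exp p = real m" by (auto elim: Nats_cases)
    obtain P Q where "polynomial_system m n P Q"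
      using polynomial_system_exists conj(1)[OF conj_m] assms(2) by (metis Suc_1 Suc_leI)
    then show ?thesis
      using polynomial_system.analytic_extension_exists[OF _ assms(1) conj(2)[OF conj_m]] by blast
  qed
  moreover have "critical_point_of_order g (pi_pn p n / 2) (m - 1) \<and>
      fps_conv_radius (taylor_fps g (pi_pn p n / 2)) = ereal (mu (conj_exp p) n)"
    if conj_m: "conj_exp p = real m" and g: "analytic_extension p n g" for m :: nat and g
  proof -
    obtain P Q where "polynomial_system m n P Q"
      using polynomial_system_exists conj(1)[OF conj_m] assms(2) by (metis Suc_1 Suc_leI)
    then interpret polynomial_system m n P Q .
    define T where "T = fps_subst_power m (- ((-1) ^ m)) P"
    have T: "(\<lambda>h. g (pi_pn p n / 2 + h)) has_fps_expansion T"
      unfolding T_def by (rule analytic_extension_has_fps_expansion[OF assms(1) conj(2)[OF conj_m] g])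
    have "fps_nth T (Suc j) = 0" if "j < m - 1" for j
      using that by (auto simp: T_def fps_subst_power_def dest: dvd_imp_le)
    moreover have "fps_nth T (Suc (m - 1)) \<noteq> 0"
      using conj_m conj(1)[OF conj_m] P_1_pos by (simp add: T_def fps_subst_power_def)
    moreover have "fps_conv_radius T = ereal (mu (conj_exp p) n)"
      unfolding T_def conj_m by (rule fps_conv_radius_subst_P[OF conj(3)[OF conj_m]]) (simp add: power_abs)
    ultimately show ?thesis
      by (simp add: critical_point_of_order_iff_fps[OF T] taylor_fps_eq[OF T])
  qed
  ultimately show ?thesis by blast
qed

end
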